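(* Let $d\ge 2$ be an integer and let $0\le p\le 1/2$. Put $$p^{\ast} = p^{\ast}(d,p) = \frac{p(d-1)}{d-(d+1)p}.$$ If the self-similar frog model $\mathrm{SFM}(d,p^{\ast})$ is recurrent, then the frog model $\mathrm{FM}(d,p)$ is also recurrent.
   Context: Let $\mathbb{T}_d$ be the infinite rooted $d$-ary tree: every vertex has $d$ children, and every vertex other than the root $\varnothing$ has one parent. Frog model $\mathrm{FM}(d,p)$, $p\in[0,1]$: discrete time; at time $0$ there is one sleeping frog at each non-root vertex and one active frog at the root. Active frogs perform independent random walks: from a non-root vertex a frog jumps to the parent with probability $p$ and to each child with probability $(1-p)/d$; from the root it jumps to each child with probability $1/d$. When an active frog visits a vertex with a sleeping frog, that frog wakes up and begins its own independent walk with the same rules. Non-backtracking frog model $\mathrm{nbFM}(d,p)$: the same initial configuration and waking rule, but the paths of active frogs are non-backtracking (a frog never returns to a site it has previously visited), and active frogs are killed upon visiting the root. The frog initially active at the root moves at every step to a uniformly chosen child. Any other frog, upon waking, makes its first step to its parent with probability $p$, or otherwise (with probability $1-p$) to a uniformly chosen child. Afterwards: (i) if the last step was upward (and the frog is not at the root, where it is killed), the next step is upward with probability $\frac{p}{p+(1-p)(d-1)/d}$, and otherwise downward to one of the $d-1$ children other than the one it just came from, equally likely; (ii) if the last step was downward, the next step is downward to a uniformly chosen child. Different frogs make independent choices. Consequently only one child of the root, denoted $\varnothing'$, is ever visited. Self-similar frog model $\mathrm{SFM}(d,p)$: $\mathrm{nbFM}(d,p)$ modified as follows. For every vertex $u\neq\varnothing$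 and every child $v$ of $u$, once $v$ has been visited for the first time (necessarily by a jump from $u$), any frog that later attempts to jump from $u$ to $v$ is killed; if several frogs attempt the first jump from $u$ to $v$ simultaneously, exactly one of them survives. Thus the subtree rooted at any such $v$ is entered from outside at most once, and, conditionally on $v$ being visited, the process restricted to that subtree (together with $u$, which plays the role of the root) is a time-shifted replica of $\mathrm{SFM}(d,p)$. A frog process is recurrent if, almost surely, there are infinitely many visits to the root. *)

theory Defs
  imports "HOL-Probability.Probability"
begin

(* The path from a vertex back to the root is its tail sequence: the root is the empty list,
   the children of x in the d-ary tree are i # x with i < d, and the parent of x is tl x.
   The vertices of the tree are thus the lists over {..<d}; lists with other entries are almost
   surely never reached, so the frogs asleep there play no role.
   Each frog is named by the vertex at which it starts. *)
type_synonym vertex = "nat list"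
type_synonym frog = vertex

definition children :: "nat \<Rightarrow> vertex \<Rightarrow> vertex set" where
  "children d x = (\<lambda>i. i # x) ` {..<d}"

definition up_else :: "real \<Rightarrow> vertex \<Rightarrow> vertex pmf \<Rightarrow> vertex pmf" where
  "up_else q x D = bernoulli_pmf q \<bind> (\<lambda>up. if up then return_pmf (tl x) else D)"

(* A kernel gives the law of the next position of a frog given the nonempty list of the
   positions it has occupied since waking, most recent first. *)
type_synonym kernel = "vertex list \<Rightarrow> vertex pmf"

(* An outcome holds an independent instruction for every frog v and every history h: where v goes
   next if its history is h. A frog never has the same history twice, so reading off the
   instructions yields independent paths, one per frog, with the transition law K. *)
type_synonym outcome = "frog \<times> vertex list \<Rightarrow> vertex"

definition frog_space :: "kernel \<Rightarrow> outcome measure" where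
  "frog_space K = (\<Pi>\<^sub>M i\<in>UNIV. measure_pmf (K (snd i)))"

primrec history :: "outcome \<Rightarrow> frog \<Rightarrow> nat \<Rightarrow> vertex list" where
  "history \<omega> v 0 = [v]"
| "history \<omega> v (Suc n) = \<omega> (v, history \<omega> v n) # history \<omega> v n"

(* Position n steps after waking, if the frog is ever woken and not killed before. *)
definition frog_path :: "outcome \<Rightarrow> frog \<Rightarrow> nat \<Rightarrow> vertex" where
  "frog_path \<omega> v n = hd (history \<omega> v n)"

definition FM_kernel :: "nat \<Rightarrow> real \<Rightarrow> kernel" where
  "FM_kernel d p h =
     (let x = hd h in
      if x = [] then pmf_of_set (children d x)
      else up_else p x (pmf_of_set (children d x)))"

(* Frogs are killed on reaching the root, so the value of the kernel at a root reached by an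
   upward step plays no role; neither does its value at the empty history. *)
fun nb_kernel :: "nat \<Rightarrow> real \<Rightarrow> kernel" where
  "nb_kernel d p [] = return_pmf []"
| "nb_kernel d p [x] =
     (if x = [] then pmf_of_set (children d x)
      else up_else p x (pmf_of_set (children d x)))"
| "nb_kernel d p (x # y # h) =
     (if y \<noteq> [] \<and> tl y = x
      then up_else (p / (p + (1 - p) * (real d - 1) / real d)) x (pmf_of_set (children d x - {y}))
      else pmf_of_set (children d x))"

(* Active n: the frog has made n steps since it was woken. *)
datatype status = Asleep | Active nat | Killed

type_synonym config = "frog \<Rightarrow> status"

definition initial :: config where
  "initial v = (if v = [] then Active 0 else Asleep)"

definition attempts :: "outcome \<Rightarrow> config \<Rightarrow> vertex \<Rightarrow> vertex \<Rightarrow> frog set" where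
  "attempts \<omega> c u v = {w. \<exists>n. c w = Active n \<and> frog_path \<omega> w n = u \<and> frog_path \<omega> w (Suc n) = v}"

primrec FM :: "outcome \<Rightarrow> nat \<Rightarrow> config" where
  "FM \<omega> 0 = initial"
| "FM \<omega> (Suc t) = (\<lambda>v. case FM \<omega> t v of
      Asleep \<Rightarrow> if \<exists>u. attempts \<omega> (FM \<omega> t) u v \<noteq> {} then Active 0 else Asleep
    | Active n \<Rightarrow> Active (Suc n)
    | Killed \<Rightarrow> Killed)"

(* Frog w attempts to jump from u to v in configuration c and is killed by the self-similarity rule.
   A vertex has been visited iff its own frog is no longer asleep. The function tb breaks ties: among
   the frogs in A attempting simultaneously the first jump from u to v, tb A survives. The tied frogs all
   continue with independent uniform downward steps, so up to the names of the frogs the law of the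
   model does not depend on tb. *)
definition blocked :: "(frog set \<Rightarrow> frog) \<Rightarrow> outcome \<Rightarrow> config \<Rightarrow> frog \<Rightarrow> vertex \<Rightarrow> vertex \<Rightarrow> bool" where
  "blocked tb \<omega> c w u v \<longleftrightarrow>
     u \<noteq> [] \<and> v \<noteq> [] \<and> tl v = u \<and> (c v \<noteq> Asleep \<or> w \<noteq> tb (attempts \<omega> c u v))"

definition tie_break :: "(frog set \<Rightarrow> frog) \<Rightarrow> bool" where
  "tie_break tb \<longleftrightarrow> (\<forall>A. finite A \<longrightarrow> A \<noteq> {} \<longrightarrow> tb A \<in> A)"

(* A frog that jumps to the root visits it and is killed there. *)
primrec SFM :: "(frog set \<Rightarrow> frog) \<Rightarrow> outcome \<Rightarrow> nat \<Rightarrow> config" where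
  "SFM tb \<omega> 0 = initial"
| "SFM tb \<omega> (Suc t) = (\<lambda>v. case SFM tb \<omega> t v of
      Asleep \<Rightarrow>
        if \<exists>u. \<exists>w\<in>attempts \<omega> (SFM tb \<omega> t) u v. \<not> blocked tb \<omega> (SFM tb \<omega> t) w u v
        then Active 0 else Asleep
    | Active n \<Rightarrow>
        if frog_path \<omega> v (Suc n) = [] \<or>
           blocked tb \<omega> (SFM tb \<omega> t) v (frog_path \<omega> v n) (frog_path \<omega> v (Suc n))
        then Killed else Active (Suc n)
    | Killed \<Rightarrow> Killed)"

(* Pairs (t, w) such that frog w jumps to the root at time t + 1; such jumps are never blocked. *)
definition root_visits :: "outcome \<Rightarrow> (nat \<Rightarrow> config) \<Rightarrow> (nat \<times> frog) set" where
  "root_visits \<omega> C = {(t, w). \<exists>u. w \<in> attempts \<omega> (C t) u []}"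

definition FM_recurrent :: "nat \<Rightarrow> real \<Rightarrow> bool" where
  "FM_recurrent d p \<longleftrightarrow>
     (AE \<omega> in frog_space (FM_kernel d p). infinite (root_visits \<omega> (FM \<omega>)))"

definition SFM_recurrent :: "(frog set \<Rightarrow> frog) \<Rightarrow> nat \<Rightarrow> real \<Rightarrow> bool" where
  "SFM_recurrent tb d p \<longleftrightarrow>
     (AE \<omega> in frog_space (nb_kernel d p). infinite (root_visits \<omega> (SFM tb \<omega>)))"

definition p_star :: "nat \<Rightarrow> real \<Rightarrow> real" where
  "p_star d p = p * (real d - 1) / (real d - (real d + 1) * p)"

end

theory Submission
  imports Defs "HOL-Library.Sublist"
begin

text \<open>
  Why recurrence transfers. Which vertices are ever awakened depends only on the range of each frog, and it
  grows with these ranges; so does the set of awakened frogs that hit the root. The times at which things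
  happen are irrelevant for this, and the rule that kills frogs in the self-similar model can only leave
  more frogs asleep. It is therefore enough to show that, frog by frog, the range of the walk in the frog
  model stochastically dominates the range of the non-backtracking walk with parameter \<open>p\<^sup>* =
  p_star d p\<close>, killed at the root: every increasing functional of the range has at least as large an
  expectation (\<open>nb_walk_dominated\<close>). As the frogs are independent, they can then be exchanged
  one at a time (\<open>Pi_pmf_dominated\<close>), which gives \<open>prob_many_visitors_dominated\<close>.

  Single-frog domination for \<open>p < 1/2\<close>. Put \<open>r = p / (1 - p)\<close>, the probability
  that the walk ever gets from a vertex to its parent. On the tree extended beyond its root, the end of the
  transient walk is found by going up a geometric number of levels, with ratio \<open>r\<close>, and then
  following a uniform downward ray; and \<open>p\<^sup>*\<close> is exactly the parameter for which the
  non-backtracking walk from \<open>v\<close> is the geodesic from \<open>v\<close> to that end. This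
  picture guides the proof, which itself needs neither the limiting end nor a coupling. Fix an increasing
  payoff \<open>F\<close> of the range and let \<open>harmonic_payoff x\<close> be the expected payoff of
  the geodesic from \<open>v\<close> to the end of a walk started at \<open>x\<close>, with a suitable value
  at the root. At \<open>x = v\<close> it bounds the payoff of the non-backtracking walk from above
  (\<open>nb_payoff_le\<close>). It is harmonic off the root, and at the root it is at most the larger of
  the payoff of stopping there and the average over the children (\<open>root_value_le\<close>). Hence it
  stays below the expected payoff of the walk (\<open>FM_payoff_ge_harmonic_payoff\<close>), up to an error
  that decays geometrically with the number of steps because the walk drifts away from the root: far from
  the root, the geodesic from \<open>v\<close> to the end typically agrees with the geodesic from
  \<open>v\<close> to the present position in all the vertices on which the payoff depends, and these have
  been visited.

  For \<open>p = 1/2\<close> the walk is not transient, but then the root frog alone returns to the root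
  infinitely often: in the limit of many steps, the probability of few returns is a bounded function of the
  height that is linear off the root, so it vanishes (\<open>few_returns_tendsto_0\<close>).
\<close>

section \<open>One step of the frog walks\<close>

lemma finite_children [simp]: "finite (children d x)"
  by (simp add: children_def)

lemma card_children [simp]: "card (children d x) = d"
  unfolding children_def by (subst card_image) (auto simp: inj_on_def)

lemma children_minus_nonempty: "2 \<le> d \<Longrightarrow> children d x - {y} \<noteq> {}"
proof
  assume "2 \<le> d" "children d x - {y} = {}"
  then have "children d x \<subseteq> {y}" by blast
  then have "card (children d x) \<le> card {y}" by (intro card_mono) auto
  then show False using \<open>2 \<le> d\<close> by simp
qed

definition child_average :: "nat \<Rightarrow> (vertex \<Rightarrow> real) \<Rightarrow> vertex \<Rightarrow> real" where
  "child_average d f x = (\<Sum>i<d. f (i # x)) / real d"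

lemma sum_children: "sum f (children d x) = (\<Sum>i<d. f (i # x))"
  unfolding children_def by (subst sum.reindex) (auto simp: inj_on_def)

lemma child_average_const: "0 < d \<Longrightarrow> child_average d (\<lambda>_. c) x = c"
  by (simp add: child_average_def)

lemma child_average_mono:
  assumes "\<And>i. i < d \<Longrightarrow> f (i # x) \<le> g (i # x)"
  shows "child_average d f x \<le> child_average d g x"
  unfolding child_average_def using assms by (intro divide_right_mono sum_mono) auto

lemma child_average_linear:
  "child_average d (\<lambda>y. a * f y + b * g y) x = a * child_average d f x + b * child_average d g x"
  by (simp add: child_average_def sum.distrib sum_distrib_left add_divide_distrib)

lemma expectation_children:
  assumes "0 < d"
  shows "measure_pmf.expectation (pmf_of_set (children d x)) f = child_average d f x"
proof -
  have "children d x \<noteq> {}" using assms by (auto simp: children_def)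
  then show ?thesis
    by (simp add: integral_pmf_of_set child_average_def sum_children)
qed

lemma expectation_siblings_le:
  assumes "2 \<le> d" "i < d" "\<And>j. j < d \<Longrightarrow> j \<noteq> i \<Longrightarrow> f (j # x) \<le> g (j # x)"
  shows "measure_pmf.expectation (pmf_of_set (children d x - {i # x})) f
    \<le> (real d * child_average d g x - g (i # x)) / (real d - 1)"
proof -
  have y: "i # x \<in> children d x" using assms(2) by (simp add: children_def)
  have c: "card (children d x - {i # x}) = d - 1" using y by simp
  have "children d x - {i # x} \<noteq> {}" using assms(1) by (rule children_minus_nonempty)
  then have "measure_pmf.expectation (pmf_of_set (children d x - {i # x})) f
      = sum f (children d x - {i # x}) / (real d - 1)"
    using c assms(1) by (simp add: integral_pmf_of_set of_nat_diff)
  also have "\<dots> \<le> sum g (children d x - {i # x}) / (real d - 1)"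
    using assms by (intro divide_right_mono sum_mono) (auto simp: children_def)
  also have "sum g (children d x - {i # x}) = sum g (children d x) - g (i # x)"
    using y by (simp add: sum_diff1)
  finally show ?thesis using assms(1) by (simp add: child_average_def sum_children)
qed

lemma expectation_up_else:
  assumes "0 \<le> q" "q \<le> 1" "finite (set_pmf D)"
  shows "measure_pmf.expectation (up_else q x D) f
    = q * f (tl x) + (1 - q) * measure_pmf.expectation D f"
proof -
  have "measure_pmf.expectation (up_else q x D) f
     = (\<Sum>b\<in>UNIV. pmf (bernoulli_pmf q) b *\<^sub>R
          measure_pmf.expectation (if b then return_pmf (tl x) else D) f)"
    unfolding up_else_def using assms by (intro pmf_expectation_bind) auto
  then show ?thesis using assms by (simp add: UNIV_bool)
qed

lemma finite_set_pmf_children: "0 < d \<Longrightarrow> finite (set_pmf (pmf_of_set (children d x)))"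
  by (subst set_pmf_of_set) (auto simp: children_def)

lemma expectation_FM_kernel:
  assumes "0 < d" "0 \<le> p" "p \<le> 1"
  shows "measure_pmf.expectation (FM_kernel d p h) f =
    (if hd h = [] then child_average d f (hd h)
     else p * f (tl (hd h)) + (1 - p) * child_average d f (hd h))"
  using assms
  by (simp add: FM_kernel_def Let_def expectation_children expectation_up_else finite_set_pmf_children)

text \<open>
  The expected payoff of the history after \<open>n\<close> more steps.
\<close>

primrec payoff_after :: "kernel \<Rightarrow> (vertex list \<Rightarrow> real) \<Rightarrow> nat \<Rightarrow> vertex list \<Rightarrow> real" where
  "payoff_after K \<Phi> 0 h = \<Phi> h"
| "payoff_after K \<Phi> (Suc n) h = measure_pmf.expectation (K h) (\<lambda>x. payoff_after K \<Phi> n (x # h))"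

text \<open>
  Histories list the most recent position first, and their last entry is the starting point, so
  \<open>butlast h\<close> holds the positions after the start: once one of them is the root, the frog is
  dead and later positions do not count. A start at the root does not kill.
\<close>

fun unkilled_range :: "vertex list \<Rightarrow> vertex set" where
  "unkilled_range [] = {}"
| "unkilled_range (x # h) =
     (if [] \<in> set (butlast h) then unkilled_range h else insert x (unkilled_range h))"

lemma unkilled_range_Cons_subset: "unkilled_range (x # h) \<subseteq> insert x (unkilled_range h)"
  by auto

lemma payoff_after_killed:
  "[] \<in> set (butlast h) \<Longrightarrow>
    payoff_after K (\<lambda>h. F (unkilled_range h)) n h = F (unkilled_range h)"
proof (induction n arbitrary: h)
  case (Suc n)
  have "payoff_after K (\<lambda>h. F (unkilled_range h)) n (x # h) = F (unkilled_range h)" for x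
    using Suc.IH[of "x # h"] Suc.prems by (cases h) auto
  then show ?case by simp
qed simp

lemma nb_kernel_after_down:
  "nb_kernel d q ((i # x) # x # g) = pmf_of_set (children d (i # x))"
proof -
  have "tl x \<noteq> i # x" by (metis length_Cons length_tl diff_le_self Suc_n_not_le_n)
  then show ?thesis by simp
qed

section \<open>Geodesics from the starting point\<close>

text \<open>
  The ancestors of a vertex, itself included, are its suffixes. The geodesic between \<open>v\<close> and
  \<open>y\<close> consists of the ancestors of either that are at least as deep as their last common
  ancestor.
\<close>

definition geodesic :: "vertex \<Rightarrow> vertex \<Rightarrow> vertex set" where
  "geodesic v y = {z. (suffix z v \<or> suffix z y) \<and> (\<forall>w. suffix w v \<and> suffix w y \<longrightarrow> suffix w z)}"

lemma geodesic_refl: "geodesic v v = {v}"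
  by (auto simp: geodesic_def dest: suffix_order.antisym)

text \<open>
  This and \<open>geodesic_step_up\<close> say that a tree has no shortcuts: a walk from \<open>v\<close>
  cannot avoid any vertex of the geodesic to its current position.
\<close>

lemma geodesic_step_down: "geodesic v (i # x) \<subseteq> insert (i # x) (geodesic v x)"
  by (auto simp: geodesic_def suffix_Cons)

lemma end_in_geodesic: "y \<in> geodesic v y"
  by (auto simp: geodesic_def)

lemma length_geodesic: "z \<in> geodesic v y \<Longrightarrow> length z \<le> max (length v) (length y)"
  by (auto simp: geodesic_def dest: suffix_length_le)

lemma not_suffix_sibling: "suffix (i # x) v \<Longrightarrow> j \<noteq> i \<Longrightarrow> \<not> suffix (j # x) v"
  by (metis list.inject length_Cons order_refl suffix_length_suffix suffix_order.antisym)

lemma not_strict_suffix_Cons: "\<not> strict_suffix x v \<Longrightarrow> \<not> strict_suffix (i # x) v"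
  by (metis strict_suffix_def suffix_ConsD not_Cons_self2 suffix_order.eq_iff suffix_Cons)

lemma geodesic_step_up: "geodesic v (tl x) \<subseteq> insert (tl x) (geodesic v x)"
proof (cases x)
  case (Cons i y)
  have "z \<in> geodesic v (i # y)" if "z \<in> geodesic v y" "z \<noteq> y" for z
  proof (cases "suffix (i # y) v")
    case True
    then have "suffix y v" by (metis suffix_ConsD)
    then have yz: "suffix y z" and z: "suffix z v \<or> suffix z y" using that(1) by (auto simp: geodesic_def)
    from z yz that(2) have zv: "suffix z v" using suffix_order.antisym by blast
    from suffix_same_cases[OF zv True] have "suffix (i # y) z"
      using yz that(2) by (metis suffix_Cons suffix_order.antisym suffix_order.refl)
    then show ?thesis using zv unfolding geodesic_def
      by (auto intro: suffix_order.trans)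
  next
    case False
    then show ?thesis using that unfolding geodesic_def by (auto simp: suffix_Cons)
  qed
  then show ?thesis using Cons by auto
qed auto

text \<open>
  Unless \<open>x\<close> lies strictly above \<open>v\<close>, the step from \<open>x\<close> to a child
  leads away from \<open>v\<close> and prolongs the geodesic.
\<close>

lemma geodesic_child:
  "\<not> strict_suffix x v \<Longrightarrow> geodesic v x \<subseteq> geodesic v (i # x)"
  by (auto simp: geodesic_def suffix_Cons strict_suffix_def)
    (metis suffix_ConsD)+

lemma geodesic_other_child:
  assumes "suffix x v" "\<not> suffix (i # x) v"
  shows "geodesic v x \<subseteq> geodesic v (i # x)"
  using assms by (auto simp: geodesic_def suffix_Cons)

lemma geodesic_ancestor:
  assumes "suffix x v"
  shows "geodesic v x = {z. suffix z v \<and> suffix x z}"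
  using assms by (auto simp: geodesic_def intro: suffix_order.trans)

section \<open>The harmonic payoff of a single frog\<close>

text \<open>
  One frog, started at \<open>v\<close>, is rewarded by an increasing function \<open>F\<close> of its
  range. The level \<open>L\<close>, below which nothing is counted, makes the payoff of a downward ray a
  finite average; it is chosen so deep that the non-backtracking walk does not pass it in the number of
  steps considered.
\<close>

locale monotone_payoff =
  fixes d :: nat and p :: real and F :: "vertex set \<Rightarrow> real" and v :: vertex and L :: nat
  assumes d: "2 \<le> d" and p: "0 \<le> p" "p < 1 / 2"
    and F_mono: "\<And>A B. A \<subseteq> B \<Longrightarrow> F A \<le> F B"
    and F_ge_0: "\<And>A. 0 \<le> F A" and F_le_1: "\<And>A. F A \<le> 1"
    and v: "set v \<subseteq> {..<d}" and v_L: "length v \<le> L"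
begin

definition r :: real where "r = p / (1 - p)"

lemma r: "0 \<le> r" "r < 1" "r * (1 - p) = p"
proof -
  have "0 < 1 - p" using p by simp
  then show "0 \<le> r" "r < 1" "r * (1 - p) = p" using p by (simp_all add: r_def)
qed

text \<open>
  Together with \<open>continuation_probability\<close>, which follows from it, this identity makes the
  number of upward steps of the non-backtracking walk the one that fits the geometric law with ratio
  \<open>r\<close>.
\<close>

lemma p_star_eq: "p_star d p * (real d - r) = r * (real d - 1)"
proof -
  have a: "(real d - r) = (real d - (real d + 1) * p) / (1 - p)"
    using p by (simp add: r_def field_simps)
  have "(real d + 1) * p < (real d + 1) * (1/2)" using p by (intro mult_strict_left_mono) auto
  then have b: "real d - (real d + 1) * p \<noteq> 0" using d by (simp add: field_simps)
  show ?thesis unfolding a using b p by (simp add: p_star_def r_def)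
qed

lemma p_star: "0 \<le> p_star d p" "p_star d p \<le> 1"
proof -
  have pos: "0 < real d - r" using r d by simp
  then have e: "p_star d p = r * (real d - 1) / (real d - r)"
    using p_star_eq by (simp add: field_simps)
  show "0 \<le> p_star d p" unfolding e using r d pos by simp
  have "r * real d \<le> 1 * real d" using r by (intro mult_right_mono) auto
  then show "p_star d p \<le> 1" unfolding e using pos by (simp add: field_simps)
qed

text \<open>
  After an upward step, the non-backtracking walk climbs further with the probability with which the
  original walk ever reaches the parent.
\<close>

lemma continuation_probability:
  "p_star d p / (p_star d p + (1 - p_star d p) * (real d - 1) / real d) = r"
proof -
  define q where "q = p_star d p"
  have pos: "0 < real d - r" using r d by simp
  have e: "q = r * (real d - 1) / (real d - r)"
    using p_star_eq pos unfolding q_def by (simp add: field_simps)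
  have "1 - q = real d * (1 - r) / (real d - r)" unfolding e using pos by (simp add: field_simps)
  then have "q + (1 - q) * (real d - 1) / real d
      = (r * (real d - 1) + (1 - r) * (real d - 1)) / (real d - r)"
    unfolding e using d pos by (simp add: add_divide_distrib)
  also have "\<dots> = (real d - 1) / (real d - r)" by (simp add: algebra_simps)
  finally show ?thesis unfolding q_def[symmetric] unfolding e using d pos by simp
qed

definition payoff_at :: "vertex \<Rightarrow> real" where
  "payoff_at x = F {z \<in> geodesic v x. length z \<le> L}"

primrec descend :: "nat \<Rightarrow> vertex \<Rightarrow> real" where
  "descend 0 x = payoff_at x"
| "descend (Suc m) x = child_average d (descend m) x"

text \<open>
  The expected payoff of the geodesic from \<open>v\<close> to the end of a uniform downward ray from
  \<open>x\<close>.
\<close>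

definition ray_payoff :: "vertex \<Rightarrow> real" where
  "ray_payoff x = descend (L - length x) x"

text \<open>
  At level \<open>L\<close> and below, hence no higher than \<open>v\<close>, a further downward step
  changes the geodesic only in vertices that are not counted.
\<close>

lemma payoff_at_deep:
  assumes "L \<le> length x"
  shows "payoff_at (i # x) = payoff_at x"
proof -
  have *: "suffix w x" if "suffix w v" "suffix w (i # x)" for w
    using that assms v_L
    by (metis Suc_n_not_le_n length_Cons order.trans suffix_Cons suffix_length_le)
  have "{z \<in> geodesic v (i # x). length z \<le> L} = {z \<in> geodesic v x. length z \<le> L}"
    using assms * by (auto simp: geodesic_def suffix_Cons)
  then show ?thesis by (simp add: payoff_at_def)
qed

lemma ray_payoff_deep: "L \<le> length x \<Longrightarrow> ray_payoff x = payoff_at x"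
  by (simp add: ray_payoff_def)

lemma ray_payoff_average: "child_average d ray_payoff x = ray_payoff x"
proof (cases "length x < L")
  case True
  then have "L - length x = Suc (L - Suc (length x))" by simp
  then have "ray_payoff x = child_average d (descend (L - Suc (length x))) x"
    unfolding ray_payoff_def by (metis descend.simps(2))
  then show ?thesis by (simp add: child_average_def ray_payoff_def)
next
  case False
  then have "ray_payoff (i # x) = ray_payoff x" for i
    by (simp add: ray_payoff_deep payoff_at_deep)
  then have "child_average d ray_payoff x = child_average d (\<lambda>_. ray_payoff x) x"
    by (simp add: child_average_def)
  then show ?thesis using d by (simp add: child_average_const)
qed

lemma payoff_at_bounds: "0 \<le> payoff_at x" "payoff_at x \<le> 1"
  by (simp_all add: payoff_at_def F_ge_0 F_le_1)

lemma ray_payoff_le_1: "ray_payoff x \<le> 1"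
proof -
  have "descend m x \<le> 1" for m
  proof (induction m arbitrary: x)
    case (Suc m)
    then have "child_average d (descend m) x \<le> child_average d (\<lambda>_. 1) x"
      by (intro child_average_mono) auto
    then show ?case using d by (simp add: child_average_const)
  qed (simp add: payoff_at_bounds)
  then show ?thesis by (simp add: ray_payoff_def)
qed

lemma payoff_at_mono: "geodesic v x \<subseteq> geodesic v y \<Longrightarrow> payoff_at x \<le> payoff_at y"
  unfolding payoff_at_def by (intro F_mono) auto

text \<open>
  The ray leads away from \<open>v\<close>, so its geodesic contains the one to its origin.
\<close>

lemma payoff_at_le_ray_payoff:
  assumes "\<not> strict_suffix x v"
  shows "payoff_at x \<le> ray_payoff x"
proof -
  have "payoff_at x \<le> descend m x" for m
    using assms
  proof (induction m arbitrary: x)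
    case (Suc m)
    have "payoff_at x \<le> descend m (i # x)" for i
    proof -
      have "\<not> strict_suffix (i # x) v" using Suc.prems by (rule not_strict_suffix_Cons)
      then have "payoff_at (i # x) \<le> descend m (i # x)" by (rule Suc.IH)
      moreover have "payoff_at x \<le> payoff_at (i # x)"
        by (intro payoff_at_mono geodesic_child Suc.prems)
      ultimately show ?thesis by simp
    qed
    then have "child_average d (\<lambda>_. payoff_at x) x \<le> child_average d (descend m) x"
      by (intro child_average_mono) auto
    then show ?case using d by (simp add: child_average_const)
  qed simp
  then show ?thesis by (simp add: ray_payoff_def)
qed

lemma payoff_at_le_sibling_ray:
  assumes "suffix x v" "\<not> suffix (i # x) v"
  shows "payoff_at x \<le> ray_payoff (i # x)"
proof -
  have "payoff_at x \<le> payoff_at (i # x)"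
    by (intro payoff_at_mono geodesic_other_child assms)
  also have "\<dots> \<le> ray_payoff (i # x)"
    using assms by (intro payoff_at_le_ray_payoff) (auto simp: strict_suffix_def)
  finally show ?thesis .
qed

text \<open>
  The expected payoff of stepping from the parent of \<open>y\<close> to a uniform child other than
  \<open>y\<close> and continuing down a uniform ray.
\<close>

definition siblings_average :: "vertex \<Rightarrow> real" where
  "siblings_average y = (real d * ray_payoff (tl y) - ray_payoff y) / (real d - 1)"

lemma suffix_v_child: "suffix (i # x) v \<Longrightarrow> i < d"
proof -
  assume "suffix (i # x) v"
  then have "set (i # x) \<subseteq> set v" by (rule set_mono_suffix)
  then show "i < d" using v by auto
qed

text \<open>
  Each of the siblings of \<open>i # x\<close> leads off the path from \<open>v\<close> to the root, hence
  away from \<open>v\<close>.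
\<close>

lemma payoff_at_le_siblings_average:
  assumes "suffix (i # x) v"
  shows "payoff_at x \<le> siblings_average (i # x)"
proof -
  have i: "i < d" by (rule suffix_v_child[OF assms])
  have sx: "suffix x v" using assms by (rule suffix_ConsD)
  have "payoff_at x \<le> ray_payoff (j # x)" if "j \<in> {..<d} - {i}" for j
    using that by (intro payoff_at_le_sibling_ray[OF sx] not_suffix_sibling[OF assms]) auto
  then have "(\<Sum>j\<in>{..<d} - {i}. payoff_at x) \<le> (\<Sum>j\<in>{..<d} - {i}. ray_payoff (j # x))"
    by (rule sum_mono)
  also have "\<dots> = (\<Sum>j<d. ray_payoff (j # x)) - ray_payoff (i # x)"
    using i by (simp add: sum_diff1)
  also have "(\<Sum>j<d. ray_payoff (j # x)) = real d * ray_payoff x"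
    using ray_payoff_average[of x] d by (simp add: child_average_def field_simps)
  finally have "(real d - 1) * payoff_at x \<le> real d * ray_payoff x - ray_payoff (i # x)"
    using i d by (simp add: of_nat_diff)
  then show ?thesis using d by (simp add: siblings_average_def field_simps)
qed

text \<open>
  The value at the root is dictated by the killed walk: for \<open>v \<noteq> []\<close> it is the one that
  makes \<open>up_payoff_root\<close> below hold, that is, that gives a frog climbing from \<open>[last
  v]\<close> to the root the payoff of being killed there. The vertex \<open>[last v]\<close> is the child
  of the root whose subtree contains \<open>v\<close>.
\<close>

definition root_value :: real where
  "root_value = (if v = [] then ray_payoff []
     else ((real d - 1) * payoff_at [] + (1 - r) * ray_payoff [last v]) / (real d - r))"

text \<open>
  Go up a geometric number of levels with ratio \<open>r\<close>, then down a uniform ray, which may well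
  lead back the way the walk came; if the climb reaches the root, the payoff is \<open>root_value\<close>.
\<close>

primrec harmonic_payoff :: "vertex \<Rightarrow> real" where
  "harmonic_payoff [] = root_value"
| "harmonic_payoff (i # x) = (1 - r) * ray_payoff (i # x) + r * harmonic_payoff x"

lemma harmonic_payoff_child_average:
  "child_average d harmonic_payoff x = (1 - r) * ray_payoff x + r * harmonic_payoff x"
proof -
  have "child_average d harmonic_payoff x
    = child_average d (\<lambda>y. (1 - r) * ray_payoff y + r * harmonic_payoff (tl y)) x"
    by (simp add: child_average_def)
  also have "\<dots> = (1 - r) * child_average d ray_payoff x
      + r * child_average d (\<lambda>y. harmonic_payoff (tl y)) x"
    by (rule child_average_linear)
  also have "child_average d (\<lambda>y. harmonic_payoff (tl y)) x = harmonic_payoff x"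
    using d by (simp add: child_average_def)
  finally show ?thesis by (simp add: ray_payoff_average)
qed

text \<open>
  With \<open>D\<close> the ray payoff of \<open>x\<close> and \<open>H\<close> the value of its parent, the
  two sides differ by \<open>(p - r (1 - p)) (1 - r) (H - D)\<close>, so harmonicity amounts to the choice
  of \<open>r\<close>.
\<close>

lemma harmonic_payoff_harmonic:
  assumes "x \<noteq> []"
  shows "p * harmonic_payoff (tl x) + (1 - p) * child_average d harmonic_payoff x
    = harmonic_payoff x"
proof -
  obtain i y where x: "x = i # y" using assms by (cases x) auto
  define D H where "D = ray_payoff (i # y)" and "H = harmonic_payoff y"
  have "p * H + (1 - p) * ((1 - r) * D + r * ((1 - r) * D + r * H)) - ((1 - r) * D + r * H)
     = (p - r * (1 - p)) * (H - D) * (1 - r)" by algebra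
  then show ?thesis
    using r(3) unfolding harmonic_payoff_child_average x by (simp add: D_def H_def)
qed

lemma root_value_le_1: "root_value \<le> 1"
proof -
  have "(real d - 1) * payoff_at [] + (1 - r) * ray_payoff [last v] \<le> (real d - 1) * 1 + (1 - r) * 1"
    using d r by (intro add_mono mult_left_mono ray_payoff_le_1 payoff_at_bounds) auto
  then have "((real d - 1) * payoff_at [] + (1 - r) * ray_payoff [last v]) / (real d - r) \<le> 1"
    using d r by simp
  then show ?thesis unfolding root_value_def by (metis ray_payoff_le_1)
qed

lemma harmonic_payoff_le_1: "harmonic_payoff x \<le> 1"
proof (induction x)
  case (Cons i x)
  have "(1 - r) * ray_payoff (i # x) + r * harmonic_payoff x \<le> (1 - r) * 1 + r * 1"
    using r Cons ray_payoff_le_1 by (intro add_mono mult_left_mono) auto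
  then show ?case by simp
qed (simp add: root_value_le_1)

text \<open>
  At the root, the better of stopping and moving on is worth at least \<open>root_value\<close>. For
  \<open>v = []\<close> this is the value of moving on. For other \<open>v\<close>, if the child
  \<open>[last v]\<close> offers no more than stopping, then \<open>root_value\<close>, an average of the
  two, is at most the payoff of stopping. Otherwise moving on is better: the ray from the root enters each
  child with probability \<open>1/d\<close>, and through all children but \<open>[last v]\<close> it
  collects the whole path from \<open>v\<close> to the root, while \<open>root_value\<close> gives
  \<open>[last v]\<close> a weight of only \<open>(1 - r) / (d - r) \<le> 1/d\<close>.
\<close>

lemma root_value_le:
  assumes "payoff_at [] \<le> u" "(1 - r) * ray_payoff [] + r * root_value - e \<le> u" "0 \<le> e"
  shows "root_value - e \<le> u"
proof (cases "v = []")
  case True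
  then have "root_value = ray_payoff []" unfolding root_value_def by (rule if_P)
  then show ?thesis using assms(2) by (simp add: algebra_simps)
next
  case False
  define i where "i = last v"
  have suf: "suffix [i] v" unfolding i_def using False
    by (metis append_butlast_last_id suffix_def)
  define F0 D1 D0 B where "F0 = payoff_at []" and "D1 = ray_payoff [i]"
    and "D0 = ray_payoff []" and "B = root_value"
  have sib: "(real d - 1) * F0 \<le> real d * D0 - D1"
    using payoff_at_le_siblings_average[OF suf] d
    by (simp add: siblings_average_def F0_def D0_def D1_def field_simps)
  have pos: "0 < real d - r" using r d by simp
  have B: "B * (real d - r) = (real d - 1) * F0 + (1 - r) * D1"
    using False pos by (simp add: B_def root_value_def F0_def D1_def i_def)
  show ?thesis
  proof (cases "D1 \<le> F0")
    case True
    then have "(1 - r) * D1 \<le> (1 - r) * F0" using r by (intro mult_left_mono) auto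
    then have "B * (real d - r) \<le> F0 * (real d - r)" unfolding B by (simp add: algebra_simps)
    then have "B \<le> F0" using pos by simp
    then show ?thesis using assms by (simp add: B_def F0_def)
  next
    case False
    have "real d * ((real d - r) * B) \<le> real d * ((real d - r) * D0)"
    proof -
      have "0 \<le> r * (real d - 1) * (D1 - F0)" using False r d by simp
      also have "r * (real d - 1) * (D1 - F0) = (real d - r) * ((real d - 1) * F0 + D1)
          - real d * ((real d - 1) * F0 + (1 - r) * D1)"
        by (simp add: algebra_simps)
      finally have "real d * ((real d - 1) * F0 + (1 - r) * D1)
          \<le> (real d - r) * ((real d - 1) * F0 + D1)" by simp
      also have "\<dots> \<le> (real d - r) * (real d * D0)"
        using sib pos by (intro mult_left_mono) auto
      finally show ?thesis unfolding B[symmetric] by (simp only: mult_ac)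
    qed
    then have "(real d - r) * B \<le> (real d - r) * D0" using d by simp
    then have "B \<le> D0" using pos by simp
    then have "(1 - r) * B \<le> (1 - r) * D0" using r by (intro mult_left_mono) auto
    then have "B \<le> (1 - r) * D0 + r * B" by (simp add: algebra_simps)
    then show ?thesis using assms(2) by (simp add: B_def D0_def)
  qed
qed

end

section \<open>Domination of a single non-backtracking frog\<close>

context monotone_payoff
begin

abbreviation nb_payoff :: "nat \<Rightarrow> vertex list \<Rightarrow> real" where
  "nb_payoff \<equiv> payoff_after (nb_kernel d (p_star d p)) (\<lambda>h. F (unkilled_range h))"

lemma payoff_le_payoff_at:
  assumes "A \<subseteq> geodesic v x" "length x \<le> L"
  shows "F A \<le> payoff_at x"
  unfolding payoff_at_def using assms v_L length_geodesic[of _ v x] by (intro F_mono) fastforce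

text \<open>
  From a step down on, the walk follows a uniform downward ray for \<open>m\<close> steps, while the ray
  payoff also counts the continuation of this ray to level \<open>L\<close>. The assumption on the kernel
  covers both a last step downward and the root frog before its first step.
\<close>

lemma nb_payoff_descending:
  assumes "nb_kernel d (p_star d p) h = pmf_of_set (children d x)" "hd h = x" "h \<noteq> []"
    "unkilled_range h \<subseteq> geodesic v x" "\<not> strict_suffix x v" "length x + m \<le> L"
  shows "nb_payoff m h \<le> ray_payoff x"
  using assms
proof (induction m arbitrary: h x)
  case 0
  then have "F (unkilled_range h) \<le> payoff_at x" by (intro payoff_le_payoff_at) auto
  also have "\<dots> \<le> ray_payoff x" using 0 by (intro payoff_at_le_ray_payoff) auto
  finally show ?case by simp
next
  case (Suc m)
  obtain g where h: "h = x # g" using Suc.prems(2,3) by (cases h) auto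
  have "nb_payoff m ((i # x) # h) \<le> ray_payoff (i # x)" for i
  proof (rule Suc.IH)
    show "nb_kernel d (p_star d p) ((i # x) # h) = pmf_of_set (children d (i # x))"
      unfolding h by (rule nb_kernel_after_down)
    show "unkilled_range ((i # x) # h) \<subseteq> geodesic v (i # x)"
      using Suc.prems(4) geodesic_child[OF Suc.prems(5), of i] end_in_geodesic[of "i # x" v]
        unkilled_range_Cons_subset[of "i # x" h] by blast
    show "\<not> strict_suffix (i # x) v" using Suc.prems(5) by (rule not_strict_suffix_Cons)
  qed (use Suc.prems in auto)
  then have "child_average d (\<lambda>c. nb_payoff m (c # h)) x \<le> child_average d ray_payoff x"
    by (intro child_average_mono) auto
  then show ?case using d by (simp add: Suc.prems(1) expectation_children ray_payoff_average)
qed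

text \<open>
  A bound for the payoff of a frog that has just stepped up from \<open>y\<close>. It is the linear
  combination of the harmonic payoff of the parent and of the ray payoff of \<open>y\<close> that removes
  from the former the rays leading back through \<open>y\<close>, which the non-backtracking walk cannot
  take.
\<close>

definition up_payoff :: "vertex \<Rightarrow> real" where
  "up_payoff y = ((real d - r) * harmonic_payoff (tl y) - (1 - r) * ray_payoff y) / (real d - 1)"

lemma up_payoff_root:
  assumes "suffix [i] v"
  shows "up_payoff [i] = payoff_at []"
proof -
  have v': "v \<noteq> []" "i = last v" using assms by (auto simp: suffix_def)
  have pos: "0 < real d - r" using r d by simp
  have "(real d - r) * root_value = (real d - 1) * payoff_at [] + (1 - r) * ray_payoff [i]"
    using v' pos unfolding root_value_def by simp
  then show ?thesis using d by (simp add: up_payoff_def)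
qed

text \<open>
  The recursion satisfied by the non-backtracking walk after an upward step.
\<close>

lemma up_payoff_step:
  "up_payoff (j # i # x) = r * up_payoff (i # x) + (1 - r) * siblings_average (j # i # x)"
proof -
  define D D' H where "D = ray_payoff (i # x)" "D' = ray_payoff (j # i # x)" "H = harmonic_payoff x"
  have "(real d - r) * ((1 - r) * D + r * H) - (1 - r) * D'
      = r * ((real d - r) * H - (1 - r) * D) + (1 - r) * (real d * D - D')"
    by (simp add: algebra_simps)
  then show ?thesis unfolding up_payoff_def siblings_average_def
    by (simp add: D_D'_H_def[symmetric] add_divide_distrib[symmetric])
qed

lemma payoff_at_le_up_payoff:
  "suffix (i # x) v \<Longrightarrow> payoff_at x \<le> up_payoff (i # x)"
proof (induction x arbitrary: i)
  case Nil
  then show ?case by (simp add: up_payoff_root)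
next
  case (Cons k x)
  have k: "suffix (k # x) v" using Cons.prems by (rule suffix_ConsD)
  have "geodesic v (k # x) \<subseteq> geodesic v x"
    using k suffix_ConsD[OF k] by (auto simp: geodesic_ancestor dest: suffix_ConsD)
  then have "payoff_at (k # x) \<le> payoff_at x" by (rule payoff_at_mono)
  also have "\<dots> \<le> up_payoff (k # x)" by (rule Cons.IH[OF k])
  finally have "r * payoff_at (k # x) + (1 - r) * payoff_at (k # x)
      \<le> r * up_payoff (k # x) + (1 - r) * siblings_average (i # k # x)"
    using r payoff_at_le_siblings_average[OF Cons.prems] by (intro add_mono mult_left_mono) auto
  then show ?case by (simp add: up_payoff_step algebra_simps)
qed

lemma expectation_siblings_le_average:
  assumes i: "suffix (i # x) v" and h: "h \<noteq> []" "hd h = x" "unkilled_range h \<subseteq> geodesic v x"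
    and L: "length x + Suc m \<le> L"
  shows "measure_pmf.expectation (pmf_of_set (children d x - {i # x})) (\<lambda>c. nb_payoff m (c # h))
    \<le> siblings_average (i # x)"
proof -
  have sx: "suffix x v" using i by (rule suffix_ConsD)
  have "nb_payoff m ((j # x) # h) \<le> ray_payoff (j # x)" if "j \<noteq> i" for j
  proof (rule nb_payoff_descending)
    obtain g where g: "h = x # g" using h(1,2) by (cases h) auto
    show "nb_kernel d (p_star d p) ((j # x) # h) = pmf_of_set (children d (j # x))"
      unfolding g by (rule nb_kernel_after_down)
    have "\<not> suffix (j # x) v" using i that by (rule not_suffix_sibling)
    then show "\<not> strict_suffix (j # x) v" by (simp add: strict_suffix_def)
    show "unkilled_range ((j # x) # h) \<subseteq> geodesic v (j # x)"
      using geodesic_other_child[OF sx \<open>\<not> suffix (j # x) v\<close>] h(3) end_in_geodesic[of "j # x" v]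
        unkilled_range_Cons_subset[of "j # x" h] by blast
  qed (use h L in auto)
  then have "measure_pmf.expectation (pmf_of_set (children d x - {i # x})) (\<lambda>c. nb_payoff m (c # h))
      \<le> (real d * child_average d ray_payoff x - ray_payoff (i # x)) / (real d - 1)"
    using d suffix_v_child[OF i] by (intro expectation_siblings_le) auto
  then show ?thesis by (simp add: siblings_average_def ray_payoff_average)
qed

text \<open>
  Induction over the remaining steps. At the root the frog is dead and its payoff is frozen; elsewhere one
  step of the walk reproduces \<open>up_payoff_step\<close>.
\<close>

lemma nb_payoff_climbing:
  assumes "suffix (i # x) v" "unkilled_range (x # (i # x) # g) \<subseteq> geodesic v x" "length x + m \<le> L"
  shows "nb_payoff m (x # (i # x) # g) \<le> up_payoff (i # x)"
  using assms
proof (induction m arbitrary: i x g)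
  case 0
  then have "F (unkilled_range (x # (i # x) # g)) \<le> payoff_at x"
    by (intro payoff_le_payoff_at) auto
  also have "\<dots> \<le> up_payoff (i # x)" using 0 by (intro payoff_at_le_up_payoff) auto
  finally show ?case by simp
next
  case (Suc m)
  define h where "h = x # (i # x) # g"
  show ?case
  proof (cases x)
    case Nil
    then have "nb_payoff (Suc m) h = F (unkilled_range h)"
      by (intro payoff_after_killed) (simp add: h_def)
    also have "\<dots> \<le> payoff_at x" using Suc.prems by (intro payoff_le_payoff_at) (auto simp: h_def)
    also have "\<dots> \<le> up_payoff (i # x)" using Suc.prems by (intro payoff_at_le_up_payoff) auto
    finally show ?thesis by (simp add: h_def)
  next
    case (Cons k y)
    have x: "suffix x v" using Suc.prems(1) by (rule suffix_ConsD)
    then have y: "suffix y v" unfolding Cons by (rule suffix_ConsD)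
    have up: "nb_payoff m (y # h) \<le> up_payoff x"
      unfolding h_def Cons
    proof (rule Suc.IH)
      show "suffix (k # y) v" using x Cons by simp
      have "geodesic v x \<subseteq> geodesic v y"
        unfolding geodesic_ancestor[OF x] geodesic_ancestor[OF y] using Cons by (auto dest: suffix_ConsD)
      then show "unkilled_range (y # (k # y) # (i # k # y) # g) \<subseteq> geodesic v y"
        using Suc.prems(2) end_in_geodesic[of y v] unkilled_range_Cons_subset[of y h]
        unfolding h_def Cons by blast
      show "length y + m \<le> L" using Suc.prems(3) Cons by simp
    qed
    have side: "measure_pmf.expectation (pmf_of_set (children d x - {i # x})) (\<lambda>c. nb_payoff m (c # h))
        \<le> siblings_average (i # x)"
      using Suc.prems by (intro expectation_siblings_le_average) (auto simp: h_def)
    have K: "nb_kernel d (p_star d p) h = up_else r x (pmf_of_set (children d x - {i # x}))"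
      by (simp add: h_def continuation_probability)
    have fin: "finite (set_pmf (pmf_of_set (children d x - {i # x})))"
      by (subst set_pmf_of_set[OF children_minus_nonempty[OF d]]) simp_all
    have "nb_payoff (Suc m) h = r * nb_payoff m (y # h) + (1 - r) *
        measure_pmf.expectation (pmf_of_set (children d x - {i # x})) (\<lambda>c. nb_payoff m (c # h))"
      using r fin by (simp add: K expectation_up_else Cons)
    also have "\<dots> \<le> r * up_payoff x + (1 - r) * siblings_average (i # x)"
      using r up side by (intro add_mono mult_left_mono) auto
    also have "\<dots> = up_payoff (i # x)" by (simp add: Cons up_payoff_step)
    finally show ?thesis by (simp add: h_def)
  qed
qed

text \<open>
  For \<open>v \<noteq> []\<close>, the first step is upward with probability \<open>p_star d p\<close>; by
  \<open>p_star_eq\<close>, the mixture of \<open>up_payoff v\<close> and \<open>ray_payoff v\<close> with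
  these weights is the harmonic payoff of \<open>v\<close>.
\<close>

lemma nb_payoff_le:
  assumes "length v + Suc m \<le> L"
  shows "nb_payoff (Suc m) [v] \<le> harmonic_payoff v"
proof (cases v)
  case Nil
  have "nb_payoff (Suc m) [[]] \<le> ray_payoff []"
    using assms by (intro nb_payoff_descending) (auto simp: Nil end_in_geodesic)
  moreover have "harmonic_payoff [] = ray_payoff []"
    unfolding harmonic_payoff.simps root_value_def using Nil by (rule if_P)
  ultimately show ?thesis unfolding Nil by simp
next
  case (Cons i x)
  define q where "q = p_star d p"
  have down: "nb_payoff m ((j # v) # [v]) \<le> ray_payoff (j # v)" for j
  proof (rule nb_payoff_descending)
    show "nb_kernel d (p_star d p) ((j # v) # [v]) = pmf_of_set (children d (j # v))"
      by (rule nb_kernel_after_down)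
    have ns: "\<not> strict_suffix v v" by simp
    show "\<not> strict_suffix (j # v) v" using not_strict_suffix_Cons[OF ns] .
    show "unkilled_range [j # v, v] \<subseteq> geodesic v (j # v)"
      using geodesic_child[OF ns, of j] end_in_geodesic[of "j # v" v] end_in_geodesic[of v v] by auto
  qed (use assms in auto)
  have "nb_payoff m (x # (i # x) # []) \<le> up_payoff (i # x)"
  proof (rule nb_payoff_climbing)
    show "suffix (i # x) v" by (simp add: Cons)
    show "unkilled_range [x, i # x] \<subseteq> geodesic v x"
      using suffix_ConsD[of i x v] by (auto simp: Cons geodesic_ancestor suffix_Cons)
    show "length x + m \<le> L" using assms Cons by simp
  qed
  then have up: "nb_payoff m (x # [v]) \<le> up_payoff v" using Cons by metis
  have "nb_payoff (Suc m) [v]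
      = q * nb_payoff m (x # [v]) + (1 - q) * child_average d (\<lambda>c. nb_payoff m (c # [v])) v"
    using p_star d by (simp add: Cons expectation_up_else expectation_children finite_set_pmf_children q_def)
  also have "\<dots> \<le> q * up_payoff v + (1 - q) * child_average d ray_payoff v"
    using p_star up down unfolding q_def by (intro add_mono mult_left_mono child_average_mono) auto
  also have "\<dots> = harmonic_payoff v"
  proof -
    define D H where "D = ray_payoff v" and "H = harmonic_payoff (tl v)"
    have d1: "real d - 1 > 0" using d by simp
    have qr: "q * (real d - r) = r * (real d - 1)" unfolding q_def by (rule p_star_eq)
    have "up_payoff v * (real d - 1) = (real d - r) * H - (1 - r) * D"
      using d1 by (simp add: up_payoff_def D_def H_def)
    then have "(q * up_payoff v + (1 - q) * D) * (real d - 1)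
        = q * ((real d - r) * H - (1 - r) * D) + (1 - q) * D * (real d - 1)"
      by (simp add: distrib_right)
    also have "\<dots> = (q * (real d - r)) * (H - D) + D * (real d - 1)"
      by (simp add: algebra_simps)
    also have "\<dots> = ((1 - r) * D + r * H) * (real d - 1)"
      unfolding qr by (simp add: algebra_simps)
    finally have "q * up_payoff v + (1 - q) * D = (1 - r) * D + r * H" using d1 by simp
    also have "\<dots> = harmonic_payoff v"
      unfolding D_def H_def by (metis Cons harmonic_payoff.simps(2) list.sel(3))
    finally show ?thesis by (simp only: ray_payoff_average D_def)
  qed
  finally show ?thesis .
qed

abbreviation FM_payoff :: "nat \<Rightarrow> vertex list \<Rightarrow> real" where
  "FM_payoff \<equiv> payoff_after (FM_kernel d p) (\<lambda>h. F (set h))"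

lemma FM_payoff_ge: "F (set h) \<le> FM_payoff n h"
proof (induction n arbitrary: h)
  case (Suc n)
  have step: "F (set h) \<le> FM_payoff n (x # h)" for x
    by (rule order_trans[OF F_mono Suc.IH[of "x # h"]]) auto
  have avg: "F (set h) \<le> child_average d (\<lambda>c. FM_payoff n (c # h)) (hd h)"
    using child_average_mono[of d "\<lambda>_. F (set h)" "hd h" "\<lambda>c. FM_payoff n (c # h)"] step d
    by (simp add: child_average_const)
  have "p * F (set h) + (1 - p) * F (set h) \<le> p * FM_payoff n (tl (hd h) # h)
      + (1 - p) * child_average d (\<lambda>c. FM_payoff n (c # h)) (hd h)"
    using step avg p by (intro add_mono mult_left_mono) auto
  then have "F (set h) \<le> p * FM_payoff n (tl (hd h) # h)
      + (1 - p) * child_average d (\<lambda>c. FM_payoff n (c # h)) (hd h)"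
    by (simp add: algebra_simps)
  then show ?case using avg p d by (cases "hd h = []") (simp_all add: expectation_FM_kernel)
qed simp

text \<open>
  At every step of the walk, the expectation of \<open>s ^ length x\<close> is multiplied by at most
  \<open>\<theta>\<close>. For \<open>r < s < 1\<close> one can take \<open>\<theta> < 1\<close>, which
  expresses the drift away from the root and makes the errors below decay.
\<close>

context
  fixes s \<theta> :: real
  assumes s: "r < s" "s < 1" and \<theta>: "s \<le> \<theta>" "p / s + (1 - p) * s \<le> \<theta>"
begin

lemma s_pos: "0 < s" using r s by simp

text \<open>
  From a vertex \<open>x\<close> deeper than \<open>L\<close>, the end lies outside the subtree of the
  ancestor at level \<open>L\<close> only if the geometric climb is longer than \<open>length x - L\<close>;
  otherwise the geodesic to the end agrees with the one to \<open>x\<close> down to level \<open>L\<close>.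
\<close>

lemma harmonic_payoff_le_payoff_at:
  "harmonic_payoff x \<le> payoff_at x + s ^ length x / s ^ L"
proof (induction x)
  case Nil
  have "1 \<le> 1 / s ^ L" using s s_pos by (simp add: power_le_one)
  then show ?case using root_value_le_1 payoff_at_bounds(1)[of "[]"] by simp
next
  case (Cons i x)
  show ?case
  proof (cases "L \<le> length x")
    case True
    have "harmonic_payoff (i # x) \<le> (1 - r) * payoff_at x + r * (payoff_at x + s ^ length x / s ^ L)"
      using Cons.IH True r by (simp add: ray_payoff_deep payoff_at_deep mult_left_mono)
    also have "\<dots> = payoff_at x + r * (s ^ length x / s ^ L)" by (simp add: algebra_simps)
    also have "\<dots> \<le> payoff_at x + s * (s ^ length x / s ^ L)"
      using s s_pos by (intro add_mono mult_right_mono) auto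
    finally show ?thesis using True by (simp add: payoff_at_deep)
  next
    case False
    then have "s ^ L \<le> s ^ length (i # x)" using s s_pos by (intro power_decreasing) auto
    then have "1 \<le> s ^ length (i # x) / s ^ L" using s_pos by simp
    then show ?thesis using harmonic_payoff_le_1[of "i # x"] payoff_at_bounds(1)[of "i # x"] by linarith
  qed
qed

text \<open>
  The harmonic payoff, lowered by the error term, is a submartingale along the walk, up to the option of
  stopping at the root; stopping costs nothing because visiting more vertices never hurts.
\<close>

lemma FM_payoff_ge_harmonic_payoff:
  assumes "h \<noteq> []" "geodesic v (hd h) \<subseteq> set h"
  shows "harmonic_payoff (hd h) - \<theta> ^ n * (s ^ length (hd h) / s ^ L) \<le> FM_payoff n h"
  using assms
proof (induction n arbitrary: h)
  case 0
  have "payoff_at (hd h) \<le> F (set h)"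
    unfolding payoff_at_def using 0 by (intro F_mono) auto
  then show ?case using harmonic_payoff_le_payoff_at[of "hd h"] by simp
next
  case (Suc n)
  define x where "x = hd h"
  define \<delta> where "\<delta> = (\<lambda>y :: vertex. \<theta> ^ n * (s ^ length y / s ^ L))"
  have IHd: "harmonic_payoff (i # x) - \<delta> (i # x) \<le> FM_payoff n ((i # x) # h)" for i
    using Suc.IH[of "(i # x) # h"] Suc.prems geodesic_step_down[of v i x] unfolding x_def \<delta>_def by auto
  have IHu: "harmonic_payoff (tl x) - \<delta> (tl x) \<le> FM_payoff n (tl x # h)"
    using Suc.IH[of "tl x # h"] Suc.prems geodesic_step_up[of v x] unfolding x_def \<delta>_def by auto
  have \<theta>_pos: "0 < \<theta>" using \<theta> s_pos by simp
  have \<delta>_pos: "0 \<le> \<delta> y" for y using \<theta>_pos s_pos by (simp add: \<delta>_def)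
  have \<delta>_child: "\<delta> (i # x) = s * \<delta> x" for i by (simp add: \<delta>_def)
  define A where "A = child_average d (\<lambda>c. FM_payoff n (c # h)) x"
  have "child_average d (\<lambda>c. 1 * harmonic_payoff c + (- 1) * \<delta> c) x \<le> A"
    unfolding A_def using IHd by (intro child_average_mono) simp
  then have A: "child_average d harmonic_payoff x - s * \<delta> x \<le> A"
    unfolding child_average_linear using d by (simp add: child_average_def \<delta>_child)
  have "harmonic_payoff x - \<theta> * \<delta> x \<le> FM_payoff (Suc n) h"
  proof (cases "x = []")
    case True
    have "FM_payoff (Suc n) h = A"
      using p d True by (simp add: expectation_FM_kernel A_def x_def)
    moreover have "root_value - s * \<delta> x \<le> A"
    proof (rule root_value_le)
      have "payoff_at [] \<le> F (set h)"
        unfolding payoff_at_def using Suc.prems True by (intro F_mono) (auto simp: x_def)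
      also have "\<dots> \<le> FM_payoff (Suc n) h" by (rule FM_payoff_ge)
      finally show "payoff_at [] \<le> A" by (simp only: \<open>FM_payoff (Suc n) h = A\<close>)
      show "(1 - r) * ray_payoff [] + r * root_value - s * \<delta> x \<le> A"
        using A True by (simp add: harmonic_payoff_child_average)
      show "0 \<le> s * \<delta> x" using s_pos \<delta>_pos by simp
    qed
    moreover have "s * \<delta> x \<le> \<theta> * \<delta> x" using \<theta> \<delta>_pos by (intro mult_right_mono)
    ultimately show ?thesis using True by simp
  next
    case False
    have "\<delta> (tl x) = \<delta> x / s" using False s_pos by (cases x) (auto simp: \<delta>_def)
    then have u: "harmonic_payoff (tl x) - \<delta> x / s \<le> FM_payoff n (tl x # h)" using IHu by simp
    have "harmonic_payoff x - \<theta> * \<delta> x \<le> harmonic_payoff x - (p / s + (1 - p) * s) * \<delta> x"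
      using \<theta>(2) \<delta>_pos[of x] by (simp add: mult_right_mono)
    also have "\<dots> = p * (harmonic_payoff (tl x) - \<delta> x / s)
        + (1 - p) * (child_average d harmonic_payoff x - s * \<delta> x)"
      using harmonic_payoff_harmonic[OF False] by (simp add: algebra_simps)
    also have "\<dots> \<le> p * FM_payoff n (tl x # h) + (1 - p) * A"
      using u A p by (intro add_mono mult_left_mono) auto
    also have "\<dots> = FM_payoff (Suc n) h"
      using p d False by (simp add: expectation_FM_kernel A_def x_def)
    finally show ?thesis .
  qed
  then show ?case by (simp add: \<delta>_def x_def mult_ac)
qed

lemma nb_payoff_le_FM_payoff:
  assumes "length v + Suc m \<le> L"
  shows "nb_payoff (Suc m) [v] \<le> FM_payoff n [v] + \<theta> ^ n * (s ^ length v / s ^ L)"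
  using nb_payoff_le[OF assms] FM_payoff_ge_harmonic_payoff[of "[v]" n] by (simp add: geodesic_refl)

end

end

text \<open>
  The error \<open>e\<close> depends on the frog and on \<open>m\<close>, but not on the payoff
  \<open>F\<close>. This uniformity is what allows several frogs to be exchanged, since the payoff of one of
  them depends on all the others.
\<close>

lemma nb_walk_dominated:
  fixes d :: nat and p :: real and v :: vertex
  assumes d: "2 \<le> d" and p: "0 \<le> p" "p < 1 / 2" and v: "set v \<subseteq> {..<d}"
  obtains e :: "nat \<Rightarrow> real" where "e \<longlonglongrightarrow> 0"
    "\<And>F n. mono F \<Longrightarrow> range F \<subseteq> {0..1} \<Longrightarrow>
      payoff_after (nb_kernel d (p_star d p)) (\<lambda>h. F (unkilled_range h)) (Suc m) [v]
        \<le> payoff_after (FM_kernel d p) (\<lambda>h. F (set h)) n [v] + e n"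
proof -
  define \<rho> where "\<rho> = p / (1 - p)"
  define s where "s = (1 + \<rho>) / 2"
  \<comment> \<open>The factors at the root and off the root; for the latter, p - s + (1 - p) s^2 is negative between its zeros p / (1 - p) and 1.\<close>
  define \<theta> where "\<theta> = max s (p / s + (1 - p) * s)"
  define L where "L = length v + Suc m"
  have r: "0 \<le> \<rho>" "\<rho> < 1" "\<rho> * (1 - p) = p" using p by (auto simp: \<rho>_def)
  have s: "\<rho> < s" "s < 1" "0 < s" using r by (auto simp: s_def)
  have "(1 - p) * ((s - \<rho>) * (1 - s)) > 0" using p s by simp
  also have "(1 - p) * ((s - \<rho>) * (1 - s))
      = s - p * s - (1 - p) * s * s - \<rho> * (1 - p) + (\<rho> * (1 - p)) * s"
    by (simp add: algebra_simps)
  finally have "0 < s - p - (1 - p) * s * s" unfolding r(3) by simp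
  then have "p / s + (1 - p) * s < 1" using s by (simp add: field_simps)
  then have \<theta>: "0 < \<theta>" "\<theta> < 1" using s by (auto simp: \<theta>_def)
  show thesis
  proof
    have "(\<lambda>n. \<theta> ^ n * (s ^ length v / s ^ L)) \<longlonglongrightarrow> 0 * (s ^ length v / s ^ L)"
      using \<theta> by (intro tendsto_mult LIMSEQ_power_zero tendsto_const) auto
    then show "(\<lambda>n. \<theta> ^ n * (s ^ length v / s ^ L)) \<longlonglongrightarrow> 0" by simp
    fix F :: "vertex set \<Rightarrow> real" and n
    assume F: "mono F" "range F \<subseteq> {0..1}"
    interpret monotone_payoff d p F v L
      using d p v F by unfold_locales (auto simp: mono_def L_def image_subset_iff)
    have "\<rho> = r" by (simp add: \<rho>_def r_def)
    then show "payoff_after (nb_kernel d (p_star d p)) (\<lambda>h. F (unkilled_range h)) (Suc m) [v]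
        \<le> payoff_after (FM_kernel d p) (\<lambda>h. F (set h)) n [v] + \<theta> ^ n * (s ^ length v / s ^ L)"
      using s \<open>\<rho> = r\<close> by (intro nb_payoff_le_FM_payoff) (auto simp: \<theta>_def L_def)
  qed
qed

section \<open>Independent families of walks\<close>

lemma nn_integral_unit_interval:
  fixes f :: "'a \<Rightarrow> real"
  assumes "range f \<subseteq> {0..1}"
  shows "(\<integral>\<^sup>+x. ennreal (f x) \<partial>measure_pmf P) = ennreal (measure_pmf.expectation P f)"
  using assms by (intro nn_integral_eq_integral measure_pmf.integrable_const_bound[where B = 1])
    (auto simp: image_subset_iff)

lemma expectation_unit_interval:
  fixes f :: "'a \<Rightarrow> real"
  assumes "range f \<subseteq> {0..1}"
  shows "measure_pmf.expectation P f \<in> {0..1}"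
proof -
  have "measure_pmf.expectation P f \<le> 1"
    using assms by (intro measure_pmf.integral_le_const measure_pmf.integrable_const_bound[where B = 1])
      (auto simp: image_subset_iff)
  then show ?thesis using assms by (auto simp: image_subset_iff intro!: integral_nonneg_AE)
qed

lemma expectation_bind_pmf:
  fixes f :: "'b \<Rightarrow> real"
  assumes f: "range f \<subseteq> {0..1}"
  shows "measure_pmf.expectation (P \<bind> N) f
    = measure_pmf.expectation P (\<lambda>x. measure_pmf.expectation (N x) f)"
proof -
  have g: "range (\<lambda>x. measure_pmf.expectation (N x) f) \<subseteq> {0..1}"
    using expectation_unit_interval[OF f] by auto
  have "ennreal (measure_pmf.expectation (P \<bind> N) f)
      = ennreal (measure_pmf.expectation P (\<lambda>x. measure_pmf.expectation (N x) f))"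
    by (simp add: nn_integral_unit_interval[OF f, symmetric] nn_integral_unit_interval[OF g, symmetric])
  then show ?thesis
    using expectation_unit_interval[OF f, of "P \<bind> N"] expectation_unit_interval[OF g, of P] by simp
qed

lemma expectation_mono_unit_interval:
  fixes f g :: "'a \<Rightarrow> real"
  assumes "range f \<subseteq> {0..1}" "range g \<subseteq> {0..1}" "\<And>x. f x \<le> g x + c"
  shows "measure_pmf.expectation P f \<le> measure_pmf.expectation P g + c"
proof -
  have "integrable (measure_pmf P) f" "integrable (measure_pmf P) g"
    using assms by (auto intro!: measure_pmf.integrable_const_bound[where B = 1] simp: image_subset_iff)
  then have "measure_pmf.expectation P f \<le> measure_pmf.expectation P (\<lambda>x. g x + c)"
    using assms by (intro integral_mono) auto
  then show ?thesis using \<open>integrable (measure_pmf P) g\<close> by simp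
qed

lemma prob_eq_expectation:
  "measure_pmf.prob P {x. A x} = measure_pmf.expectation P (\<lambda>x. of_bool (A x))"
proof -
  have "(\<lambda>x. of_bool (A x)) = (indicator {x. A x} :: _ \<Rightarrow> real)" by (auto simp: indicator_def)
  then show ?thesis by simp
qed

primrec walk_pmf :: "kernel \<Rightarrow> vertex \<Rightarrow> nat \<Rightarrow> vertex list pmf" where
  "walk_pmf K v 0 = return_pmf [v]"
| "walk_pmf K v (Suc n) = walk_pmf K v n \<bind> (\<lambda>h. map_pmf (\<lambda>x. x # h) (K h))"

lemma payoff_after_Suc_last:
  "payoff_after K \<Phi> (Suc n) h
    = payoff_after K (\<lambda>h. measure_pmf.expectation (K h) (\<lambda>x. \<Phi> (x # h))) n h"
  by (induction n arbitrary: h) simp_all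

lemma expectation_walk_pmf:
  "range \<Phi> \<subseteq> {0..1} \<Longrightarrow> measure_pmf.expectation (walk_pmf K v n) \<Phi> = payoff_after K \<Phi> n [v]"
proof (induction n arbitrary: \<Phi>)
  case (Suc n)
  have "range (\<lambda>h. measure_pmf.expectation (K h) (\<lambda>x. \<Phi> (x # h))) \<subseteq> {0..1}"
    using expectation_unit_interval[of "\<lambda>x. \<Phi> (x # _)"] Suc.prems by (auto simp: image_subset_iff)
  note IH = Suc.IH[OF this]
  show ?case
    unfolding walk_pmf.simps expectation_bind_pmf[OF Suc.prems] payoff_after_Suc_last IH[symmetric]
    by simp
qed simp

text \<open>
  Coordinates are exchanged one after the other: with the remaining ones fixed or averaged, an increasing
  functional is an increasing functional of the coordinate being exchanged.
\<close>

lemma Pi_pmf_dominated: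
  fixes P Q :: "'a \<Rightarrow> 'b set pmf" and e :: "'a \<Rightarrow> real"
  assumes "finite V"
    and "\<And>v F. v \<in> V \<Longrightarrow> mono F \<Longrightarrow> range F \<subseteq> {0..1} \<Longrightarrow>
      measure_pmf.expectation (P v) F \<le> measure_pmf.expectation (Q v) F + e v"
    and "mono \<Phi>" "range \<Phi> \<subseteq> {0..1 :: real}"
  shows "measure_pmf.expectation (Pi_pmf V {} P) \<Phi> \<le> measure_pmf.expectation (Pi_pmf V {} Q) \<Phi> + sum e V"
  using assms
proof (induction V arbitrary: \<Phi> rule: finite_induct)
  case (insert v V)
  have split: "measure_pmf.expectation (Pi_pmf (insert v V) {} R) \<Phi>
      = measure_pmf.expectation (R v)
          (\<lambda>y. measure_pmf.expectation (Pi_pmf V {} R) (\<lambda>f. \<Phi> (f(v := y))))" for R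
    using insert.hyps insert.prems(3) by (simp add: Pi_pmf_insert' expectation_bind_pmf)
  have rng: "range (\<lambda>f. \<Phi> (f(v := y))) \<subseteq> {0..1}" for y
    using insert.prems(3) by auto
  have m: "mono (\<lambda>f. \<Phi> (f(v := y)))" for y
    using insert.prems(2) by (auto intro!: monoI monoD[OF insert.prems(2)] simp: le_fun_def)
  define G where "G R = (\<lambda>y. measure_pmf.expectation (Pi_pmf V {} R) (\<lambda>f. \<Phi> (f(v := y))))" for R
  have G_rng: "range (G R) \<subseteq> {0..1}" for R
    using expectation_unit_interval[OF rng] by (auto simp: G_def)
  have "mono (G Q)"
  proof (rule monoI)
    fix y y' :: "'b set"
    assume "y \<le> y'"
    then have "\<Phi> (f(v := y)) \<le> \<Phi> (f(v := y')) + 0" for f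
      by (auto intro!: monoD[OF insert.prems(2)] simp: le_fun_def)
    then show "G Q y \<le> G Q y'"
      unfolding G_def using expectation_mono_unit_interval[OF rng rng, of y y' 0] by simp
  qed
  have "measure_pmf.expectation (P v) (G P) \<le> measure_pmf.expectation (P v) (G Q) + sum e V"
  proof (rule expectation_mono_unit_interval[OF G_rng G_rng])
    fix y
    show "G P y \<le> G Q y + sum e V"
      unfolding G_def by (rule insert.IH[OF _ m rng]) (use insert.prems(1) in blast)
  qed
  also have "measure_pmf.expectation (P v) (G Q) \<le> measure_pmf.expectation (Q v) (G Q) + e v"
    using \<open>mono (G Q)\<close> G_rng by (intro insert.prems(1)) auto
  finally show ?case unfolding split G_def[symmetric] using insert.hyps by simp
qed simp

lemma space_frog_space [simp]: "space (frog_space K) = UNIV"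
  by (simp add: frog_space_def space_PiM)

lemma prob_space_frog_space: "prob_space (frog_space K)"
  unfolding frog_space_def by (intro prob_space_PiM prob_space_measure_pmf)

text \<open>
  A given history is a cylinder event: it prescribes the instruction at each of its nonempty proper tails.
\<close>

lemma history_eq_iff:
  "history \<omega> v n = h \<longleftrightarrow>
    length h = Suc n \<and> last h = v \<and> (\<forall>j<n. \<omega> (v, drop (Suc j) h) = h ! j)"
proof (induction n arbitrary: h)
  case 0
  then show ?case by (cases h) auto
next
  case (Suc n)
  show ?case
  proof (cases h)
    case (Cons x g)
    have "history \<omega> v (Suc n) = h \<longleftrightarrow> \<omega> (v, g) = x \<and> history \<omega> v n = g"
      using Cons by auto
    also have "\<dots> \<longleftrightarrow> \<omega> (v, drop (Suc 0) h) = h ! 0 \<and> length g = Suc n \<and> last g = v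
        \<and> (\<forall>j<n. \<omega> (v, drop (Suc (Suc j)) h) = h ! Suc j)"
      by (simp add: Suc.IH Cons)
    also have "\<dots> \<longleftrightarrow> length h = Suc (Suc n) \<and> last h = v
        \<and> (\<forall>j<Suc n. \<omega> (v, drop (Suc j) h) = h ! j)"
      unfolding All_less_Suc2 using Cons by auto
    finally show ?thesis .
  qed simp
qed

lemma pmf_walk_pmf:
  "pmf (walk_pmf K v n) h =
    (if length h = Suc n \<and> last h = v then \<Prod>j<n. pmf (K (drop (Suc j) h)) (h ! j) else 0)"
proof (induction n arbitrary: h)
  case 0
  then show ?case by (cases h) (auto simp: pmf_return)
next
  case (Suc n)
  have e: "pmf (map_pmf (\<lambda>x. x # h') (K h')) h
    = (if h \<noteq> [] \<and> h' = tl h then pmf (K (tl h)) (hd h) else 0)" for h'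
  proof (cases "h \<noteq> [] \<and> h' = tl h")
    case True
    then have "h = (\<lambda>x. x # h') (hd h)" by simp
    then have "pmf (map_pmf (\<lambda>x. x # h') (K h')) h = pmf (K h') (hd h)"
      by (metis (mono_tags, lifting) pmf_map_inj' injI list.inject)
    then show ?thesis using True by simp
  next
    case False
    then show ?thesis by (auto simp: pmf_eq_0_set_pmf)
  qed
  show ?case
  proof (cases h)
    case Nil
    have "pmf (walk_pmf K v (Suc n)) h = measure_pmf.expectation (walk_pmf K v n) (\<lambda>_. 0)"
      unfolding walk_pmf.simps pmf_bind e by (simp add: Nil)
    then show ?thesis by (simp add: Nil)
  next
    case (Cons x g)
    have "pmf (walk_pmf K v (Suc n)) h
        = measure_pmf.expectation (walk_pmf K v n) (\<lambda>h'. indicator {g} h' * pmf (K g) x)"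
      unfolding walk_pmf.simps pmf_bind e by (intro Bochner_Integration.integral_cong refl) (auto simp: Cons indicator_def)
    also have "\<dots> = pmf (walk_pmf K v n) g * pmf (K g) x"
      by (simp add: measure_pmf_single)
    also have "\<dots> = (if length h = Suc (Suc n) \<and> last h = v
        then \<Prod>j<Suc n. pmf (K (drop (Suc j) h)) (h ! j) else 0)"
      unfolding Suc.IH prod.lessThan_Suc_shift using Cons by auto
    finally show ?thesis .
  qed
qed

text \<open>
  The instructions prescribed by the histories of several frogs have distinct indices: the frog tells the
  histories apart, and within one history the lengths of its tails do.
\<close>

lemma emeasure_histories:
  assumes "finite V"
  shows "{\<omega>. \<forall>v\<in>V. history \<omega> v n = f v} \<in> sets (frog_space K)" (is "?A \<in> _")
    and "emeasure (frog_space K) {\<omega>. \<forall>v\<in>V. history \<omega> v n = f v}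
      = (\<Prod>v\<in>V. ennreal (pmf (walk_pmf K v n) (f v)))"
proof -
  interpret P: product_prob_space "\<lambda>i. measure_pmf (K (snd i))" UNIV
    by unfold_locales
  have *: "?A \<in> sets (frog_space K) \<and>
      emeasure (frog_space K) ?A = (\<Prod>v\<in>V. ennreal (pmf (walk_pmf K v n) (f v)))"
  proof (cases "\<forall>v\<in>V. length (f v) = Suc n \<and> last (f v) = v")
    case False
    then have empty: "?A = {}" by (auto simp: history_eq_iff)
    have "\<exists>v\<in>V. pmf (walk_pmf K v n) (f v) = 0" using False by (auto simp: pmf_walk_pmf)
    then have "(\<Prod>v\<in>V. ennreal (pmf (walk_pmf K v n) (f v))) = 0"
      by (intro prod_zero[OF assms]) auto
    then show ?thesis unfolding empty by simp
  next
    case True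
    \<comment> \<open>The instruction with index (v, t) is the entry of f v in front of its tail t, which is found from the length of t.\<close>
    define \<iota> where "\<iota> = (\<lambda>(v, j). (v, drop (Suc j) (f v)))"
    define J where "J = \<iota> ` (V \<times> {..<n})"
    define X :: "frog \<times> vertex list \<Rightarrow> vertex set" where "X = (\<lambda>(v, t). {f v ! (n - length t)})"
    have X: "X (\<iota> (v, j)) = {f v ! j}" if "v \<in> V" "j < n" for v j
      using True that by (simp add: X_def \<iota>_def)
    have A: "?A = {\<omega> \<in> space (Pi\<^sub>M UNIV (\<lambda>i. measure_pmf (K (snd i)))). \<forall>i\<in>J. \<omega> i \<in> X i}"
      using True by (auto simp: history_eq_iff J_def X space_PiM) (auto simp: \<iota>_def X_def)
    have fin: "finite J" using assms by (simp add: J_def)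
    have inj: "inj_on \<iota> (V \<times> {..<n})"
    proof (rule inj_onI, clarsimp simp: \<iota>_def)
      fix v i j
      assume "v \<in> V" "i < n" "j < n" "drop (Suc i) (f v) = drop (Suc j) (f v)"
      then have "length (f v) - Suc i = length (f v) - Suc j" by (metis length_drop)
      then show "i = j" using True \<open>v \<in> V\<close> \<open>i < n\<close> \<open>j < n\<close> by simp
    qed
    have "emeasure (frog_space K) ?A = (\<Prod>i\<in>J. emeasure (measure_pmf (K (snd i))) (X i))"
      unfolding frog_space_def A using fin by (intro P.emeasure_PiM_Collect) auto
    also have "\<dots> = (\<Prod>x\<in>V \<times> {..<n}. emeasure (measure_pmf (K (snd (\<iota> x)))) (X (\<iota> x)))"
      unfolding J_def by (subst prod.reindex[OF inj]) simp
    also have "\<dots> = (\<Prod>(v, j)\<in>V \<times> {..<n}. ennreal (pmf (K (drop (Suc j) (f v))) (f v ! j)))"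
      by (intro prod.cong refl) (auto simp: X emeasure_pmf_single, simp add: \<iota>_def)
    also have "\<dots> = (\<Prod>v\<in>V. \<Prod>j<n. ennreal (pmf (K (drop (Suc j) (f v))) (f v ! j)))"
      by (rule prod.cartesian_product[symmetric])
    also have "\<dots> = (\<Prod>v\<in>V. ennreal (pmf (walk_pmf K v n) (f v)))"
      using True by (intro prod.cong) (auto simp: pmf_walk_pmf prod_ennreal)
    finally have "emeasure (frog_space K) ?A = \<dots>" .
    moreover have "?A \<in> sets (frog_space K)"
    proof (cases "J = {}")
      case True
      then have "?A = space (frog_space K)" unfolding A by (simp add: space_PiM)
      then show ?thesis by (metis sets.top)
    next
      case False
      then show ?thesis
        unfolding frog_space_def A
        by (intro sets.sets_Collect_finite_All'[OF _ fin]) (auto intro!: sets_Collect_single)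
    qed
    ultimately show ?thesis by simp
  qed
  show "?A \<in> sets (frog_space K)" using * by blast
  show "emeasure (frog_space K) ?A = (\<Prod>v\<in>V. ennreal (pmf (walk_pmf K v n) (f v)))" using * by blast
qed

definition histories :: "frog set \<Rightarrow> nat \<Rightarrow> outcome \<Rightarrow> frog \<Rightarrow> vertex list" where
  "histories V n \<omega> = (\<lambda>v. if v \<in> V then history \<omega> v n else [])"

lemma countable_functions_with_default:
  fixes V :: "'a set" and z :: "'b :: countable"
  assumes "finite V"
  shows "countable {f. \<forall>v. v \<notin> V \<longrightarrow> f v = z}"
proof -
  have "countable (PiE V (\<lambda>_. UNIV :: 'b set))" using assms by (intro countable_PiE) auto
  then have "countable ((\<lambda>g v. if v \<in> V then g v else z) ` PiE V (\<lambda>_. UNIV))" by (rule countable_image)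
  moreover have "{f. \<forall>v. v \<notin> V \<longrightarrow> f v = z} \<subseteq> (\<lambda>g v. if v \<in> V then g v else z) ` PiE V (\<lambda>_. UNIV)"
  proof
    fix f :: "'a \<Rightarrow> 'b"
    assume "f \<in> {f. \<forall>v. v \<notin> V \<longrightarrow> f v = z}"
    then have "f = (\<lambda>v. if v \<in> V then restrict f V v else z)" by (auto simp: fun_eq_iff)
    then show "f \<in> (\<lambda>g v. if v \<in> V then g v else z) ` PiE V (\<lambda>_. UNIV)"
      by (intro image_eqI[of _ _ "restrict f V"]) auto
  qed
  ultimately show ?thesis by (rule countable_subset[rotated])
qed

text \<open>
  Two measures that charge only countably many points and agree on these are equal.
\<close>

lemma distr_histories:
  assumes V: "finite V"
  shows "histories V n \<in> measurable (frog_space K) (count_space UNIV)"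
    and "distr (frog_space K) (count_space UNIV) (histories V n)
      = measure_pmf (Pi_pmf V [] (\<lambda>v. walk_pmf K v n))"
proof -
  define R :: "(frog \<Rightarrow> vertex list) set" where "R = {f. \<forall>v. v \<notin> V \<longrightarrow> f v = []}"
  have R: "countable R" unfolding R_def by (rule countable_functions_with_default[OF V])
  have in_R: "histories V n \<omega> \<in> R" for \<omega> by (simp add: R_def histories_def)
  have fib: "{\<omega>. histories V n \<omega> = f} = {\<omega>. \<forall>v\<in>V. history \<omega> v n = f v}" if "f \<in> R" for f
    using that by (auto simp: R_def histories_def fun_eq_iff)
  show meas: "histories V n \<in> measurable (frog_space K) (count_space UNIV)"
  proof (rule measurableI)
    fix A :: "(frog \<Rightarrow> vertex list) set"
    have "histories V n -` A \<inter> space (frog_space K) = (\<Union>f\<in>A \<inter> R. {\<omega>. histories V n \<omega> = f})"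
      using in_R by auto
    also have "\<dots> \<in> sets (frog_space K)"
    proof (intro sets.countable_UN' countable_Int2 R)
      show "(\<lambda>f. {\<omega>. histories V n \<omega> = f}) ` (A \<inter> R) \<subseteq> sets (frog_space K)"
        using emeasure_histories(1)[OF V] by (auto simp: fib)
    qed
    finally show "histories V n -` A \<inter> space (frog_space K) \<in> sets (frog_space K)" .
  qed simp
  let ?D = "distr (frog_space K) (count_space UNIV) (histories V n)"
  let ?Q = "measure_pmf (Pi_pmf V [] (\<lambda>v. walk_pmf K v n))"
  have single: "emeasure ?D {f} = emeasure ?Q {f}" if "f \<in> R" for f
  proof -
    have "emeasure ?D {f} = emeasure (frog_space K) {\<omega>. histories V n \<omega> = f}"
      using meas by (subst emeasure_distr) (auto simp: vimage_def)
    also have "\<dots> = (\<Prod>v\<in>V. ennreal (pmf (walk_pmf K v n) (f v)))"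
      using that by (simp add: fib emeasure_histories(2)[OF V])
    also have "\<dots> = emeasure ?Q {f}"
      using that V by (simp add: emeasure_pmf_single pmf_Pi' R_def prod_ennreal)
    finally show ?thesis .
  qed
  show "?D = ?Q"
  proof (rule measure_eqI)
    fix A :: "(frog \<Rightarrow> vertex list) set"
    have AR: "countable (A \<inter> R)" using R by blast
    have "emeasure ?D A = emeasure ?D (A \<inter> R)"
      using meas in_R by (subst (1 2) emeasure_distr) (auto intro!: arg_cong[where f = "emeasure _"])
    also have "\<dots> = (\<integral>\<^sup>+f. emeasure ?D {f} \<partial>count_space (A \<inter> R))"
      by (rule emeasure_countable_singleton[OF _ AR]) simp
    also have "\<dots> = (\<integral>\<^sup>+f. emeasure ?Q {f} \<partial>count_space (A \<inter> R))"
      by (intro nn_integral_cong) (simp add: single)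
    also have "\<dots> = emeasure ?Q (A \<inter> R)"
      by (rule emeasure_countable_singleton[symmetric, OF _ AR]) simp
    also have "\<dots> = emeasure ?Q A"
      using set_Pi_pmf_subset[OF V, of "[]" "\<lambda>v. walk_pmf K v n"]
      by (intro emeasure_eq_AE) (auto simp: AE_measure_pmf_iff R_def)
    finally show "emeasure ?D A = emeasure ?Q A" .
  qed simp
qed

lemma measure_histories:
  assumes "finite V"
  shows "measure (frog_space K) {\<omega>. \<Psi> (histories V n \<omega>)}
      = measure_pmf.prob (Pi_pmf V [] (\<lambda>v. walk_pmf K v n)) {f. \<Psi> f}"
    and "{\<omega>. \<Psi> (histories V n \<omega>)} \<in> sets (frog_space K)"
proof -
  note m = distr_histories(1)[OF assms, of n K]
  have v: "{\<omega>. \<Psi> (histories V n \<omega>)} = histories V n -` {f. \<Psi> f} \<inter> space (frog_space K)" by auto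
  show "{\<omega>. \<Psi> (histories V n \<omega>)} \<in> sets (frog_space K)"
    unfolding v using m by (rule measurable_sets) simp
  show "measure (frog_space K) {\<omega>. \<Psi> (histories V n \<omega>)}
      = measure_pmf.prob (Pi_pmf V [] (\<lambda>v. walk_pmf K v n)) {f. \<Psi> f}"
    unfolding distr_histories(2)[OF assms, symmetric] v using m by (subst measure_distr) auto
qed

section \<open>Awakened frogs as a closure\<close>

text \<open>
  The frogs that are woken eventually if frog \<open>w\<close>, once awake, visits the vertices in \<open>R
  w\<close>.
\<close>

inductive_set awakened :: "(frog \<Rightarrow> vertex set) \<Rightarrow> frog set" for R where
  root: "[] \<in> awakened R"
| visit: "w \<in> awakened R \<Longrightarrow> x \<in> R w \<Longrightarrow> x \<in> awakened R"

definition root_visitors :: "(frog \<Rightarrow> vertex set) \<Rightarrow> frog set" where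
  "root_visitors R = {w \<in> awakened R. w \<noteq> [] \<and> [] \<in> R w}"

definition many_visitors :: "nat \<Rightarrow> (frog \<Rightarrow> vertex set) \<Rightarrow> bool" where
  "many_visitors k R \<longleftrightarrow> (\<exists>W\<subseteq>root_visitors R. finite W \<and> card W = k)"

lemma awakened_mono:
  assumes "\<And>w. R w \<subseteq> R' w"
  shows "awakened R \<subseteq> awakened R'"
proof
  fix w assume "w \<in> awakened R"
  then show "w \<in> awakened R'"
    by induction (use assms in \<open>auto intro: awakened.intros\<close>)
qed

lemma root_visitors_mono: "(\<And>w. R w \<subseteq> R' w) \<Longrightarrow> root_visitors R \<subseteq> root_visitors R'"
  using awakened_mono[of R R'] by (auto simp: root_visitors_def)

lemma many_visitors_mono: "(\<And>w. R w \<subseteq> R' w) \<Longrightarrow> many_visitors k R \<Longrightarrow> many_visitors k R'"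
  unfolding many_visitors_def using root_visitors_mono[of R R'] by (metis order_trans)

text \<open>
  Each awakening is witnessed by a finite chain of frogs, each of which has walked for a finite time.
\<close>

lemma awakened_UN:
  fixes R :: "nat \<Rightarrow> frog \<Rightarrow> vertex set"
  assumes "\<And>w. incseq (\<lambda>N. R N w)"
  shows "awakened (\<lambda>w. \<Union>N. R N w) = (\<Union>N. awakened (R N))"
proof
  show "awakened (\<lambda>w. \<Union>N. R N w) \<subseteq> (\<Union>N. awakened (R N))"
  proof
    fix w assume "w \<in> awakened (\<lambda>w. \<Union>N. R N w)"
    then show "w \<in> (\<Union>N. awakened (R N))"
    proof induction
      case root
      then show ?case by (auto intro: awakened.root)
    next
      case (visit w x)
      then obtain N M where w: "w \<in> awakened (R N)" and x: "x \<in> R M w" by auto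
      have "w \<in> awakened (R (max N M))"
        using w awakened_mono[of "R N" "R (max N M)"] incseqD[OF assms, of N "max N M"] by auto
      moreover have "x \<in> R (max N M) w" using x incseqD[OF assms, of M "max N M"] by auto
      ultimately show ?case by (auto intro: awakened.visit)
    qed
  qed
  show "(\<Union>N. awakened (R N)) \<subseteq> awakened (\<lambda>w. \<Union>N. R N w)"
    by (intro UN_least awakened_mono) auto
qed

lemma many_visitors_UN:
  fixes R :: "nat \<Rightarrow> frog \<Rightarrow> vertex set"
  assumes inc: "\<And>w. incseq (\<lambda>N. R N w)" and inf: "infinite (root_visitors (\<lambda>w. \<Union>N. R N w))"
  obtains N where "many_visitors k (R N)"
proof -
  have inc_rv: "incseq (\<lambda>N. root_visitors (R N))"
    using incseqD[OF inc] by (intro monoI root_visitors_mono) auto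
  have "root_visitors (\<lambda>w. \<Union>N. R N w) \<subseteq> (\<Union>N. root_visitors (R N))"
  proof
    fix w assume "w \<in> root_visitors (\<lambda>w. \<Union>N. R N w)"
    then obtain N M where N: "w \<in> awakened (R N)" "w \<noteq> []" and M: "[] \<in> R M w"
      unfolding root_visitors_def awakened_UN[OF inc] by auto
    have "w \<in> awakened (R (max N M))"
      using N awakened_mono[of "R N" "R (max N M)"] incseqD[OF inc, of N "max N M"] by auto
    moreover have "[] \<in> R (max N M) w" using M incseqD[OF inc, of M "max N M"] by auto
    ultimately show "w \<in> (\<Union>N. root_visitors (R N))" using N(2) by (auto simp: root_visitors_def)
  qed
  then have sub: "W \<subseteq> (\<Union>N. root_visitors (R N))" if "W \<subseteq> root_visitors (\<lambda>w. \<Union>N. R N w)" for W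
    using that by blast
  obtain W where W: "W \<subseteq> root_visitors (\<lambda>w. \<Union>N. R N w)" "finite W" "card W = k"
    using infinite_arbitrarily_large[OF inf] by blast
  have "\<exists>N. W \<subseteq> root_visitors (R N)"
    using W(2) sub[OF W(1)]
  proof induction
    case (insert w W)
    then obtain N M where "W \<subseteq> root_visitors (R N)" "w \<in> root_visitors (R M)" by auto
    then have "insert w W \<subseteq> root_visitors (R (max N M))"
      using incseqD[OF inc_rv, of N "max N M"] incseqD[OF inc_rv, of M "max N M"] by auto
    then show ?case by blast
  qed simp
  then show thesis using W that by (auto simp: many_visitors_def)
qed

section \<open>From the two models to closures and back\<close>

lemma set_history: "set (history \<omega> v n) = frog_path \<omega> v ` {..n}"
  by (induction n) (auto simp: frog_path_def atMost_Suc)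

lemma history_not_Nil [simp]: "history \<omega> v n \<noteq> []"
  by (cases n) auto

lemma set_butlast_history: "set (butlast (history \<omega> v n)) = frog_path \<omega> v ` {1..n}"
  by (induction n) (auto simp: frog_path_def atLeastAtMostSuc_conv)

lemma frog_path_in_unkilled_range:
  assumes "\<And>m. 0 < m \<Longrightarrow> m < j \<Longrightarrow> frog_path \<omega> v m \<noteq> []" "j \<le> n"
  shows "frog_path \<omega> v j \<in> unkilled_range (history \<omega> v n)"
  using assms(2)
proof (induction n)
  case (Suc n)
  show ?case
  proof (cases "j = Suc n")
    case True
    then have "[] \<notin> set (butlast (history \<omega> v n))"
      using assms(1) unfolding set_butlast_history image_iff
      by (metis Suc_le_eq atLeastAtMost_iff le_imp_less_Suc One_nat_def)
    then show ?thesis using True by (simp add: frog_path_def)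
  qed (use Suc in auto)
qed (simp add: frog_path_def)

lemma incseq_unkilled_range: "incseq (\<lambda>n. unkilled_range (history \<omega> v n))"
  by (intro incseq_SucI) auto

lemma FM_Active_add: "FM \<omega> t v = Active n \<Longrightarrow> FM \<omega> (t + j) v = Active (n + j)"
  by (induction j) auto

lemma FM_awakens:
  assumes "w \<in> awakened (\<lambda>w. if w \<in> V then set (history \<omega> w n) else {})"
  shows "\<exists>t. FM \<omega> t w = Active 0"
  using assms
proof induction
  case root
  have "FM \<omega> 0 [] = Active 0" by (simp add: initial_def)
  then show ?case by blast
next
  case (visit w x)
  then obtain t where t: "FM \<omega> t w = Active 0" by auto
  obtain j where j: "frog_path \<omega> w j = x" using visit.hyps(2) by (auto simp: set_history split: if_splits)
  show ?case
  proof (cases j)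
    case 0
    then have "w = x" using j by (simp add: frog_path_def)
    then show ?thesis using t by blast
  next
    case (Suc i)
    have "FM \<omega> (t + i) w = Active i" using FM_Active_add[OF t] by simp
    then have att: "w \<in> attempts \<omega> (FM \<omega> (t + i)) (frog_path \<omega> w i) x"
      using j Suc by (auto simp: attempts_def)
    have woken: "FM \<omega> (Suc (t + i)) x \<noteq> Asleep"
      using att by (auto split: status.splits)
    have "\<exists>s\<le>t. FM \<omega> s x = Active 0" if "FM \<omega> t x \<noteq> Asleep" for t
      using that
    proof (induction t)
      case 0
      then show ?case by (auto simp: initial_def split: if_splits)
    next
      case (Suc t)
      show ?case
      proof (cases "FM \<omega> t x = Asleep")
        case True
        then have "FM \<omega> (Suc t) x = Active 0" using Suc.prems by (auto split: if_splits)
        then show ?thesis by blast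
      next
        case False
        then show ?thesis using Suc.IH le_SucI by blast
      qed
    qed
    then show ?thesis using woken by blast
  qed
qed

text \<open>
  In the frog model no frog is ever killed, so an awakened frog walks its whole path, only later.
\<close>

lemma FM_recurrent_if_many_visitors:
  assumes "\<And>k. \<exists>V n. many_visitors k (\<lambda>w. if w \<in> V then set (history \<omega> w n) else {})"
  shows "infinite (root_visits \<omega> (FM \<omega>))"
proof
  assume fin: "finite (root_visits \<omega> (FM \<omega>))"
  obtain V n where "many_visitors (Suc (card (snd ` root_visits \<omega> (FM \<omega>))))
      (\<lambda>w. if w \<in> V then set (history \<omega> w n) else {})"
    using assms by blast
  then obtain W where
    W: "W \<subseteq> root_visitors (\<lambda>w. if w \<in> V then set (history \<omega> w n) else {})"
      "card W = Suc (card (snd ` root_visits \<omega> (FM \<omega>)))"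
    by (auto simp: many_visitors_def)
  have "W \<subseteq> snd ` root_visits \<omega> (FM \<omega>)"
  proof
    fix w assume "w \<in> W"
    then have w: "w \<in> awakened (\<lambda>w. if w \<in> V then set (history \<omega> w n) else {})" "w \<noteq> []"
      "[] \<in> set (history \<omega> w n)"
      using W by (auto simp: root_visitors_def split: if_splits)
    obtain t where t: "FM \<omega> t w = Active 0" using FM_awakens[OF w(1)] by blast
    obtain j where j: "frog_path \<omega> w j = []" using w(3) unfolding set_history by (metis imageE)
    then obtain i where i: "j = Suc i" using w(2) by (cases j) (auto simp: frog_path_def)
    have "FM \<omega> (t + i) w = Active i" using FM_Active_add[OF t] by simp
    then have "(t + i, w) \<in> root_visits \<omega> (FM \<omega>)"
      using j i by (auto simp: root_visits_def attempts_def)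
    then show "w \<in> snd ` root_visits \<omega> (FM \<omega>)" by force
  qed
  then have "card W \<le> card (snd ` root_visits \<omega> (FM \<omega>))" using fin by (intro card_mono) auto
  then show False using W by simp
qed

lemma SFM_Active_path:
  "SFM tb \<omega> t w = Active n \<Longrightarrow> 0 < m \<Longrightarrow> m \<le> n \<Longrightarrow> frog_path \<omega> w m \<noteq> []"
proof (induction t arbitrary: n)
  case 0
  then show ?case by (simp add: initial_def split: if_splits)
next
  case (Suc t)
  show ?case
  proof (cases "SFM tb \<omega> t w")
    case Asleep
    then show ?thesis using Suc.prems by (auto split: if_splits)
  next
    case (Active i)
    then have "n = Suc i" "frog_path \<omega> w (Suc i) \<noteq> []" using Suc.prems(1) by (auto split: if_splits)
    then show ?thesis using Suc.IH[OF Active] Suc.prems by (cases "m = Suc i") auto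
  qed (use Suc.prems in auto)
qed

text \<open>
  A truncation that involves finitely many frogs and finitely many of their steps, and exhausts the ranges
  of all frogs in the tree as \<open>N\<close> grows.
\<close>

definition SFM_range :: "nat \<Rightarrow> outcome \<Rightarrow> nat \<Rightarrow> frog \<Rightarrow> vertex set" where
  "SFM_range d \<omega> N w =
    (if set w \<subseteq> {..<d} \<and> length w \<le> N then unkilled_range (history \<omega> w (Suc N)) else {})"

lemma SFM_range_incseq: "incseq (\<lambda>N. SFM_range d \<omega> N w)"
  using incseqD[OF incseq_unkilled_range[of \<omega> w]] by (intro incseq_SucI) (auto simp: SFM_range_def)

lemma frog_path_in_SFM_range:
  assumes "SFM tb \<omega> t w = Active n" "set w \<subseteq> {..<d}"
  shows "frog_path \<omega> w (Suc n) \<in> (\<Union>N. SFM_range d \<omega> N w)"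
proof -
  have "frog_path \<omega> w (Suc n) \<in> SFM_range d \<omega> (max n (length w)) w"
  proof -
    have "frog_path \<omega> w (Suc n) \<in> unkilled_range (history \<omega> w (Suc (max n (length w))))"
      by (intro frog_path_in_unkilled_range SFM_Active_path[OF assms(1)]) auto
    then show ?thesis using assms(2) by (simp add: SFM_range_def del: history.simps)
  qed
  then show ?thesis by blast
qed

text \<open>
  A frog of the self-similar model moves along its path until it is killed, at the root or earlier, so the
  vertices it visits are in its unkilled range.
\<close>

lemma SFM_awakened:
  assumes path: "\<And>w n. set w \<subseteq> {..<d} \<Longrightarrow> set (frog_path \<omega> w n) \<subseteq> {..<d}"
  shows "SFM tb \<omega> t v \<noteq> Asleep \<Longrightarrow> v \<in> awakened (\<lambda>w. \<Union>N. SFM_range d \<omega> N w) \<and> set v \<subseteq> {..<d}"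
proof (induction t arbitrary: v)
  case 0
  then show ?case by (auto simp: initial_def intro: awakened.root split: if_splits)
next
  case (Suc t)
  show ?case
  proof (cases "SFM tb \<omega> t v = Asleep")
    case True
    then obtain u w where "w \<in> attempts \<omega> (SFM tb \<omega> t) u v"
      using Suc.prems by (auto split: if_splits)
    then obtain n where n: "SFM tb \<omega> t w = Active n" "frog_path \<omega> w (Suc n) = v"
      by (auto simp: attempts_def)
    then have w: "w \<in> awakened (\<lambda>w. \<Union>N. SFM_range d \<omega> N w)" "set w \<subseteq> {..<d}"
      using Suc.IH[of w] by auto
    have "v \<in> (\<Union>N. SFM_range d \<omega> N w)"
      using frog_path_in_SFM_range[OF n(1) w(2)] n(2) by simp
    then show ?thesis using awakened.visit[OF w(1)] path[OF w(2), of "Suc n"] n(2) by simp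
  qed (use Suc.IH in auto)
qed

lemma SFM_Killed_add: "SFM tb \<omega> t v = Killed \<Longrightarrow> SFM tb \<omega> (t + j) v = Killed"
  by (induction j) auto

text \<open>
  A frog is killed when it visits the root, so infinitely many visits are due to infinitely many frogs.
\<close>

lemma inj_on_SFM_root_visits: "inj_on snd (root_visits \<omega> (SFM tb \<omega>))"
proof -
  have killed: "SFM tb \<omega> (Suc t) w = Killed" if "(t, w) \<in> root_visits \<omega> (SFM tb \<omega>)" for t w
    using that by (auto simp: root_visits_def attempts_def)
  have active: "SFM tb \<omega> t w \<noteq> Killed" if "(t, w) \<in> root_visits \<omega> (SFM tb \<omega>)" for t w
    using that by (auto simp: root_visits_def attempts_def)
  have "\<not> t < t'" if "(t, w) \<in> root_visits \<omega> (SFM tb \<omega>)" "(t', w) \<in> root_visits \<omega> (SFM tb \<omega>)" for t t' w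
  proof
    assume "t < t'"
    then have "Suc t + (t' - Suc t) = t'" by simp
    then have "SFM tb \<omega> t' w = Killed"
      using SFM_Killed_add[OF killed[OF that(1)], of "t' - Suc t"] by metis
    then show False using active[OF that(2)] by simp
  qed
  then show ?thesis unfolding inj_on_def by (metis linorder_neqE_nat prod.collapse)
qed

lemma SFM_infinite_root_visitors:
  assumes path: "\<And>w n. set w \<subseteq> {..<d} \<Longrightarrow> set (frog_path \<omega> w n) \<subseteq> {..<d}"
    and inf: "infinite (root_visits \<omega> (SFM tb \<omega>))"
  shows "infinite (root_visitors (\<lambda>w. \<Union>N. SFM_range d \<omega> N w))"
proof -
  have "infinite (snd ` root_visits \<omega> (SFM tb \<omega>) - {[]})"
    using inf finite_imageD[OF _ inj_on_SFM_root_visits] by auto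
  moreover have "snd ` root_visits \<omega> (SFM tb \<omega>) - {[]} \<subseteq> root_visitors (\<lambda>w. \<Union>N. SFM_range d \<omega> N w)"
  proof
    fix w assume "w \<in> snd ` root_visits \<omega> (SFM tb \<omega>) - {[]}"
    then obtain t n where n: "SFM tb \<omega> t w = Active n" "frog_path \<omega> w (Suc n) = []" "w \<noteq> []"
      by (auto simp: root_visits_def attempts_def)
    then have w: "w \<in> awakened (\<lambda>w. \<Union>N. SFM_range d \<omega> N w)" "set w \<subseteq> {..<d}"
      using SFM_awakened[of d \<omega> tb t w] path by auto
    then show "w \<in> root_visitors (\<lambda>w. \<Union>N. SFM_range d \<omega> N w)"
      using frog_path_in_SFM_range[OF n(1) w(2)] n by (simp add: root_visitors_def)
  qed
  ultimately show ?thesis by (meson infinite_super)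
qed

lemma set_tl_subset: "set (tl x) \<subseteq> set x"
  by (cases x) auto

lemma set_pmf_up_else: "set_pmf (up_else q x D) \<subseteq> insert (tl x) (set_pmf D)"
  by (auto simp: up_else_def split: if_splits)

lemma set_pmf_nb_kernel:
  assumes "2 \<le> d" "set (hd h) \<subseteq> {..<d}" "h \<noteq> []" "z \<in> set_pmf (nb_kernel d q h)"
  shows "set z \<subseteq> {..<d}"
proof -
  have C: "set_pmf (pmf_of_set (children d x)) = children d x" for x
    using assms(1) by (intro set_pmf_of_set) (simp_all add: children_def lessThan_empty_iff)
  have C': "set_pmf (pmf_of_set (children d x - {y})) = children d x - {y}" for x y
    by (intro set_pmf_of_set children_minus_nonempty assms(1)) simp
  obtain x g where h: "h = x # g" using assms(3) by (cases h) auto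
  have "z \<in> insert (tl x) (children d x)"
  proof (cases g)
    case Nil
    then show ?thesis using assms(4)
      by (auto simp: h C split: if_splits dest!: subsetD[OF set_pmf_up_else])
  next
    case (Cons y g')
    then show ?thesis using assms(4)
      by (auto simp: h C C' split: if_splits dest!: subsetD[OF set_pmf_up_else])
  qed
  then show ?thesis using assms(2) set_tl_subset[of x] by (auto simp: h children_def)
qed

lemma AE_frog_path_in_tree:
  assumes "2 \<le> d"
  shows "AE \<omega> in frog_space (nb_kernel d q). \<forall>w n. set w \<subseteq> {..<d} \<longrightarrow> set (frog_path \<omega> w n) \<subseteq> {..<d}"
proof -
  have "AE \<omega> in frog_space (nb_kernel d q). \<omega> i \<in> set_pmf (nb_kernel d q (snd i))" for i
    unfolding frog_space_def
    by (rule AE_PiM_component) (auto simp: prob_space_measure_pmf AE_measure_pmf)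
  then have "AE \<omega> in frog_space (nb_kernel d q). \<forall>i. \<omega> i \<in> set_pmf (nb_kernel d q (snd i))"
    by (subst AE_all_countable) blast
  then show ?thesis
  proof (rule AE_mp, intro AE_I2 impI allI)
    fix \<omega> :: outcome and w n
    assume step: "\<forall>i. \<omega> i \<in> set_pmf (nb_kernel d q (snd i))" and w: "set w \<subseteq> {..<d}"
    show "set (frog_path \<omega> w n) \<subseteq> {..<d}"
    proof (induction n)
      case (Suc n)
      have "\<omega> (w, history \<omega> w n) \<in> set_pmf (nb_kernel d q (history \<omega> w n))"
        using step by (metis snd_conv)
      then show ?case
        using set_pmf_nb_kernel[OF assms _ history_not_Nil] Suc.IH by (simp add: frog_path_def)
    qed (use w in \<open>simp add: frog_path_def\<close>)
  qed
qed

section \<open>The driftless walk\<close>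

text \<open>
  For \<open>p = 1/2\<close>, the height of the walk is a simple random walk reflected at \<open>0\<close>.
  This is the probability that, started at height \<open>x\<close>, it enters \<open>0\<close> fewer than
  \<open>k\<close> times during the next \<open>n\<close> steps.
\<close>

primrec few_returns :: "nat \<Rightarrow> nat \<Rightarrow> nat \<Rightarrow> real" where
  "few_returns 0 k x = of_bool (0 < k)"
| "few_returns (Suc n) k x =
     (if k = 0 then 0
      else if x = 0 then few_returns n k 1
      else ((if x = 1 then few_returns n (k - 1) 0 else few_returns n k (x - 1))
        + few_returns n k (x + 1)) / 2)"

lemma few_returns_0: "few_returns n 0 x = 0"
  by (cases n) auto

lemma few_returns_bounds: "0 \<le> few_returns n k x \<and> few_returns n k x \<le> 1"
proof (induction n arbitrary: k x)
  case (Suc n)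
  then show ?case
    using add_mono[of "few_returns n (k - 1) 0" 1 "few_returns n k (x + 1)" 1]
      add_mono[of "few_returns n k (x - 1)" 1 "few_returns n k (x + 1)" 1] by auto
qed simp

lemma few_returns_decseq: "decseq (\<lambda>n. few_returns n k x)"
proof (intro decseq_SucI)
  fix n show "few_returns (Suc n) k x \<le> few_returns n k x"
  proof (induction n arbitrary: k x)
    case 0
    then show ?case using few_returns_bounds[of "Suc 0" k x] by (cases "k = 0") (auto simp del: few_returns.simps(2) simp: few_returns_0)
  next
    case (Suc n)
    then show ?case
      using Suc.IH[of k 1] Suc.IH[of "k - 1" 0] Suc.IH[of k "x - 1"] Suc.IH[of k "x + 1"]
      unfolding few_returns.simps(2)[of "Suc n"] few_returns.simps(2)[of n k x]
      by (auto simp del: few_returns.simps intro!: divide_right_mono add_mono)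
  qed
qed

text \<open>
  The limit \<open>l\<close> in \<open>n\<close> exists by monotonicity. By induction on \<open>k\<close>,
  entering \<open>0\<close> contributes nothing in the limit, so \<open>l\<close>, with its value at
  \<open>0\<close> replaced by \<open>0\<close>, has vanishing second differences. It is thus linear, and
  being bounded it is zero.
\<close>

lemma few_returns_tendsto_0: "(\<lambda>n. few_returns n k x) \<longlonglongrightarrow> 0"
proof (induction k arbitrary: x)
  case 0
  then show ?case by (simp add: few_returns_0)
next
  case (Suc k)
  have "\<exists>l. (\<lambda>n. few_returns n (Suc k) x) \<longlonglongrightarrow> l" for x
    using decseq_convergent[OF few_returns_decseq, of 0 "Suc k" x] few_returns_bounds by metis
  then obtain l where l: "(\<lambda>n. few_returns n (Suc k) x) \<longlonglongrightarrow> l x" for x by metis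
  define a where "a x = (if x = 0 then 0 else l x)" for x
  have l1: "l x \<le> 1" for x
    by (rule LIMSEQ_le_const2[OF l]) (use few_returns_bounds in blast)
  have l0: "0 \<le> l x" for x
    by (rule LIMSEQ_le_const[OF l]) (use few_returns_bounds in blast)
  have l': "(\<lambda>n. few_returns (Suc n) (Suc k) x) \<longlonglongrightarrow> l x" for x
    using l by (rule LIMSEQ_Suc)
  have step: "l (Suc x) = (a x + a (Suc (Suc x))) / 2" for x
  proof (rule LIMSEQ_unique[OF l'])
    have "(\<lambda>n. if x = 0 then few_returns n k 0 else few_returns n (Suc k) x) \<longlonglongrightarrow> a x"
      using Suc.IH[of 0] l[of x] by (simp add: a_def)
    then have "(\<lambda>n. ((if x = 0 then few_returns n k 0 else few_returns n (Suc k) x)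
        + few_returns n (Suc k) (Suc (Suc x))) / 2) \<longlonglongrightarrow> (a x + a (Suc (Suc x))) / 2"
      using l[of "Suc (Suc x)"] by (intro tendsto_intros) (auto simp: a_def)
    then show "(\<lambda>n. few_returns (Suc n) (Suc k) (Suc x)) \<longlonglongrightarrow> (a x + a (Suc (Suc x))) / 2"
      by (simp cong: if_cong)
  qed
  have rec: "a (Suc (Suc x)) = 2 * a (Suc x) - a x" for x
    using step[of x] by (simp add: a_def split: if_splits)
  have lin: "a x = real x * a 1 \<and> a (Suc x) = real (Suc x) * a 1" for x
  proof (induction x)
    case (Suc x)
    then show ?case unfolding rec[of x] by (simp add: algebra_simps)
  qed (simp add: a_def)
  have "a 1 = 0"
  proof (rule ccontr)
    assume "a 1 \<noteq> 0"
    moreover have "0 \<le> a 1" using l0 by (simp add: a_def)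
    ultimately have pos: "0 < a 1" by simp
    obtain N where "1 < real N * a 1" using reals_Archimedean3[OF pos] by blast
    then show False using lin[of N] l1[of N] by (auto simp: a_def split: if_splits)
  qed
  then have a0: "a x = 0" for x using lin[of x] by simp
  have "l 0 = l 1"
    by (rule LIMSEQ_unique[OF l']) (use l[of 1] in simp)
  then have "l x = 0" for x using a0[of x] a0[of 1] by (cases "x = 0") (auto simp: a_def)
  then show ?case using l by metis
qed

lemma payoff_after_few_returns:
  assumes "0 < d" "h \<noteq> []" "count_list h [] \<le> k"
  shows "payoff_after (FM_kernel d (1 / 2)) (\<lambda>h. of_bool (count_list h [] < k)) n h
    = few_returns n (k - count_list h []) (length (hd h))"
  using assms(2,3)
proof (induction n arbitrary: h)
  case 0
  then show ?case by simp
next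
  case (Suc n)
  define \<Phi> :: "vertex list \<Rightarrow> real" where "\<Phi> = (\<lambda>h. of_bool (count_list h [] < k))"
  define U where "U = payoff_after (FM_kernel d (1 / 2)) \<Phi>"
  obtain x g where h: "h = x # g" using Suc.prems(1) by (cases h) auto
  show ?case
  proof (cases "count_list h [] = k")
    case True
    have dead: "U n h = 0" if "k \<le> count_list h []" for n h
      using that
    proof (induction n arbitrary: h)
      case (Suc n)
      then have "U n (y # h) = 0" for y by (intro Suc.IH) auto
      then show ?case by (simp add: U_def)
    qed (simp add: U_def \<Phi>_def)
    show ?thesis using dead[of h "Suc n"] True by (simp only: U_def \<Phi>_def) (simp add: few_returns_0)
  next
    case False
    define c where "c = count_list h []"
    have c: "c < k" using False Suc.prems by (simp add: c_def)
    have IH: "U n (y # h) = few_returns n (k - (if y = [] then Suc c else c)) (length y)" for y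
      using Suc.IH[of "y # h"] c by (simp add: U_def \<Phi>_def c_def)
    have "U (Suc n) h = (if x = [] then child_average d (\<lambda>y. U n (y # h)) x
        else 1 / 2 * U n (tl x # h) + (1 - 1 / 2) * child_average d (\<lambda>y. U n (y # h)) x)"
      using assms(1) by (simp add: U_def expectation_FM_kernel h)
    also have "child_average d (\<lambda>y. U n (y # h)) x = few_returns n (k - c) (Suc (length x))"
      using assms(1) by (simp add: IH child_average_def)
    finally have "U (Suc n) h = few_returns (Suc n) (k - c) (length x)"
      using c by (cases x) (auto simp: IH add_divide_distrib)
    then show ?thesis by (simp only: U_def \<Phi>_def c_def h list.sel(1))
  qed
qed

text \<open>
  The frog that is active initially suffices.
\<close>

lemma FM_recurrent_half:
  assumes "0 < d"
  shows "FM_recurrent d (1 / 2)"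
proof -
  define K where "K = FM_kernel d (1 / 2)"
  interpret prob_space "frog_space K" by (rule prob_space_frog_space)
  define B where "B k n = {\<omega>. count_list (histories {[]} n \<omega> []) [] < k}" for k n
  have meas: "B k n \<in> events" for k n
    unfolding B_def using measure_histories(2)[of "{[]}" "\<lambda>f. count_list (f []) [] < k" n K] by simp
  have prob_B: "prob (B k n) = few_returns n (k - 1) 0" if "1 \<le> k" for k n
  proof -
    have "prob (B k n) = measure_pmf.prob (Pi_pmf {[]} [] (\<lambda>v. walk_pmf K v n)) {f. count_list (f []) [] < k}"
      unfolding B_def using measure_histories(1)[of "{[]}" K "\<lambda>f. count_list (f []) [] < k" n] by simp
    also have "\<dots> = measure_pmf.prob (map_pmf (\<lambda>f. f []) (Pi_pmf {[]} [] (\<lambda>v. walk_pmf K v n)))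
        {h. count_list h [] < k}"
      by (simp add: vimage_def)
    also have "map_pmf (\<lambda>f. f []) (Pi_pmf {[]} [] (\<lambda>v. walk_pmf K v n)) = walk_pmf K [] n"
      by (simp add: Pi_pmf_component)
    also have "measure_pmf.prob (walk_pmf K [] n) {h. count_list h [] < k}
        = measure_pmf.expectation (walk_pmf K [] n) (\<lambda>h. of_bool (count_list h [] < k))"
      by (rule prob_eq_expectation)
    also have "\<dots> = payoff_after K (\<lambda>h. of_bool (count_list h [] < k)) n [[]]"
      by (intro expectation_walk_pmf) auto
    also have "\<dots> = few_returns n (k - 1) 0"
      using payoff_after_few_returns[OF assms, of "[[]]" k n] that by (simp add: K_def)
    finally show ?thesis .
  qed
  have "AE \<omega> in frog_space K. \<exists>n. \<omega> \<notin> B k n" if "1 \<le> k" for k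
  proof -
    have "prob (\<Inter>n. B k n) \<le> few_returns n (k - 1) 0" for n
      using finite_measure_mono[of "\<Inter>n. B k n" "B k n"] meas prob_B[OF that] by auto
    then have "prob (\<Inter>n. B k n) \<le> 0"
      by (intro LIMSEQ_le_const[OF few_returns_tendsto_0]) auto
    then have "(\<Inter>n. B k n) \<in> null_sets (frog_space K)"
      using meas by (auto simp: null_sets_def emeasure_eq_measure measure_le_0_iff)
    then have "AE \<omega> in frog_space K. \<omega> \<notin> (\<Inter>n. B k n)" by (rule AE_not_in)
    then show ?thesis by simp
  qed
  then have "AE \<omega> in frog_space K. \<forall>k\<in>{1..}. \<exists>n. \<omega> \<notin> B k n"
    by (subst AE_ball_countable) auto
  then have "AE \<omega> in frog_space K. infinite (root_visits \<omega> (FM \<omega>))"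
  proof (rule AE_mp, intro AE_I2 impI)
    fix \<omega> :: outcome
    assume many: "\<forall>k\<in>{1..}. \<exists>n. \<omega> \<notin> B k n"
    have act: "FM \<omega> t [] = Active t" for t
      using FM_Active_add[of \<omega> 0 "[]" 0 t] by (simp add: initial_def)
    have count: "count_list (history \<omega> [] n) [] = card {j. j \<le> n \<and> frog_path \<omega> [] j = []}" for n
    proof (induction n)
      case 0
      have "{j. j \<le> 0 \<and> frog_path \<omega> [] j = []} = {0}" by (auto simp: frog_path_def)
      then show ?case by simp
    next
      case (Suc n)
      have "{j. j \<le> Suc n \<and> frog_path \<omega> [] j = []} = {j. j \<le> n \<and> frog_path \<omega> [] j = []}
          \<union> (if frog_path \<omega> [] (Suc n) = [] then {Suc n} else {})"
        by (auto simp: le_Suc_eq)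
      then show ?case using Suc.IH by (auto simp: frog_path_def card_insert_if)
    qed
    have "infinite {j. frog_path \<omega> [] j = []}"
    proof
      assume fin: "finite {j. frog_path \<omega> [] j = []}"
      obtain n where "\<omega> \<notin> B (Suc (card {j. frog_path \<omega> [] j = []})) n" using many by auto
      then have "card {j. frog_path \<omega> [] j = []} < count_list (history \<omega> [] n) []"
        by (simp add: B_def histories_def)
      moreover have "card {j. j \<le> n \<and> frog_path \<omega> [] j = []} \<le> card {j. frog_path \<omega> [] j = []}"
        using fin by (intro card_mono) auto
      ultimately show False by (simp add: count)
    qed
    moreover have "{j. frog_path \<omega> [] j = []} - {0} \<subseteq> Suc ` fst ` root_visits \<omega> (FM \<omega>)"
    proof
      fix j assume "j \<in> {j. frog_path \<omega> [] j = []} - {0}"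
      then obtain t where "j = Suc t" "frog_path \<omega> [] (Suc t) = []" by (cases j) auto
      then have "(t, []) \<in> root_visits \<omega> (FM \<omega>)" using act by (auto simp: root_visits_def attempts_def)
      then show "j \<in> Suc ` fst ` root_visits \<omega> (FM \<omega>)" using \<open>j = Suc t\<close> by force
    qed
    ultimately show "infinite (root_visits \<omega> (FM \<omega>))"
      by (meson finite_Diff2 finite.emptyI finite.insertI finite_imageI finite_subset)
  qed
  then show ?thesis unfolding FM_recurrent_def K_def .
qed

section \<open>Comparison of the two models\<close>

text \<open>
  On the left, only finitely many frogs and steps matter, so the frogs can be exchanged at the cost of a
  finite sum of errors, which vanishes as the number \<open>n\<close> of steps granted to the new frogs
  grows.
\<close>

lemma prob_many_visitors_dominated:
  fixes d :: nat and p :: real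
  assumes d: "2 \<le> d" and p: "0 \<le> p" "p < 1 / 2"
  shows "measure (frog_space (nb_kernel d (p_star d p))) {\<omega>. many_visitors k (SFM_range d \<omega> N)}
    \<le> measure (frog_space (FM_kernel d p))
        {\<omega>. \<exists>V\<in>{V. finite V}. \<exists>n. many_visitors k (\<lambda>w. set (histories V n \<omega> w))}"
    (is "?nb \<le> measure ?M ?E")
proof -
  interpret prob_space ?M by (rule prob_space_frog_space)
  define V :: "vertex set" where "V = {w. set w \<subseteq> {..<d} \<and> length w \<le> N}"
  have V: "finite V" unfolding V_def by (rule finite_lists_length_le) simp
  have "\<exists>e. e \<longlonglongrightarrow> 0 \<and> (\<forall>F n. mono F \<longrightarrow> range F \<subseteq> {0..1} \<longrightarrow>
      payoff_after (nb_kernel d (p_star d p)) (\<lambda>h. F (unkilled_range h)) (Suc N) [v]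
        \<le> payoff_after (FM_kernel d p) (\<lambda>h. F (set h)) n [v] + e n)" if "v \<in> V" for v
  proof -
    have "set v \<subseteq> {..<d}" using that by (simp add: V_def)
    from nb_walk_dominated[OF d p this, of N] show ?thesis by metis
  qed
  then obtain e where e0: "\<And>v. v \<in> V \<Longrightarrow> e v \<longlonglongrightarrow> 0"
    and e: "\<And>v F n. v \<in> V \<Longrightarrow> mono F \<Longrightarrow> range F \<subseteq> {0..1} \<Longrightarrow>
      payoff_after (nb_kernel d (p_star d p)) (\<lambda>h. F (unkilled_range h)) (Suc N) [v]
        \<le> payoff_after (FM_kernel d p) (\<lambda>h. F (set h)) n [v] + e v n"
    by metis
  define \<Phi> :: "(frog \<Rightarrow> vertex set) \<Rightarrow> real" where "\<Phi> R = of_bool (many_visitors k R)" for R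
  have \<Phi>: "mono \<Phi>" "range \<Phi> \<subseteq> {0..1}"
  proof -
    show "mono \<Phi>"
    proof (rule monoI)
      fix R R' :: "frog \<Rightarrow> vertex set"
      assume "R \<le> R'"
      then have "many_visitors k R \<Longrightarrow> many_visitors k R'"
        using many_visitors_mono[of R R' k] by (simp add: le_fun_def)
      then show "\<Phi> R \<le> \<Phi> R'" by (simp add: \<Phi>_def)
    qed
  qed (auto simp: \<Phi>_def)
  have prob_eq: "measure (frog_space K) {\<omega>. many_visitors k (\<lambda>w. \<rho> (histories V n \<omega> w))}
      = measure_pmf.expectation (Pi_pmf V {} (\<lambda>v. map_pmf \<rho> (walk_pmf K v n))) \<Phi>"
    if "\<rho> [] = {}" for \<rho> K n
  proof -
    have "measure (frog_space K) {\<omega>. many_visitors k (\<lambda>w. \<rho> (histories V n \<omega> w))}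
        = measure_pmf.prob (Pi_pmf V [] (\<lambda>v. walk_pmf K v n)) {f. many_visitors k (\<lambda>w. \<rho> (f w))}"
      by (rule measure_histories(1)[OF V])
    also have "\<dots> = measure_pmf.expectation (Pi_pmf V [] (\<lambda>v. walk_pmf K v n)) (\<lambda>f. \<Phi> (\<rho> \<circ> f))"
      by (simp add: prob_eq_expectation \<Phi>_def comp_def)
    also have "\<dots> = measure_pmf.expectation (map_pmf (\<lambda>f. \<rho> \<circ> f) (Pi_pmf V [] (\<lambda>v. walk_pmf K v n))) \<Phi>"
      by simp
    also have "map_pmf (\<lambda>f. \<rho> \<circ> f) (Pi_pmf V [] (\<lambda>v. walk_pmf K v n))
        = Pi_pmf V {} (\<lambda>v. map_pmf \<rho> (walk_pmf K v n))"
      by (rule Pi_pmf_map[where f = \<rho> and dflt = "[]", OF V that, symmetric])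
    finally show ?thesis .
  qed
  have bound: "?nb \<le> prob ?E + (\<Sum>v\<in>V. e v n)" for n
  proof -
    have "SFM_range d \<omega> N = (\<lambda>w. unkilled_range (histories V (Suc N) \<omega> w))" for \<omega>
      by (auto simp: SFM_range_def histories_def V_def fun_eq_iff simp del: history.simps)
    then have "?nb = measure_pmf.expectation
        (Pi_pmf V {} (\<lambda>v. map_pmf unkilled_range (walk_pmf (nb_kernel d (p_star d p)) v (Suc N)))) \<Phi>"
      using prob_eq[of unkilled_range "nb_kernel d (p_star d p)" "Suc N"] by simp
    also have "\<dots> \<le> measure_pmf.expectation
        (Pi_pmf V {} (\<lambda>v. map_pmf set (walk_pmf (FM_kernel d p) v n))) \<Phi> + (\<Sum>v\<in>V. e v n)"
    proof (rule Pi_pmf_dominated[OF V _ \<Phi>])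
      fix v and F :: "vertex set \<Rightarrow> real"
      assume v: "v \<in> V" and F: "mono F" "range F \<subseteq> {0..1}"
      have rng: "range (\<lambda>h. F (\<rho> h)) \<subseteq> {0..1}" for \<rho> :: "vertex list \<Rightarrow> vertex set"
        using F(2) by auto
      show "measure_pmf.expectation (map_pmf unkilled_range (walk_pmf (nb_kernel d (p_star d p)) v (Suc N))) F
          \<le> measure_pmf.expectation (map_pmf set (walk_pmf (FM_kernel d p) v n)) F + e v n"
        using e[OF v F] by (simp only: integral_map_pmf expectation_walk_pmf[OF rng])
    qed
    also have "measure_pmf.expectation
        (Pi_pmf V {} (\<lambda>v. map_pmf set (walk_pmf (FM_kernel d p) v n))) \<Phi>
        = prob {\<omega>. many_visitors k (\<lambda>w. set (histories V n \<omega> w))}"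
      by (rule prob_eq[symmetric]) simp
    also have "\<dots> \<le> prob ?E"
    proof (rule finite_measure_mono)
      have "countable {V :: vertex set. finite V}"
        using countable_Collect_finite by simp
      moreover have "?E = (\<Union>V\<in>{V. finite V}. \<Union>n. {\<omega>. many_visitors k (\<lambda>w. set (histories V n \<omega> w))})"
        by auto
      ultimately show "?E \<in> events"
        using measure_histories(2)[of _ "\<lambda>f. many_visitors k (\<lambda>w. set (f w))"]
        by (auto intro!: sets.countable_UN'')
    qed (use V in auto)
    finally show ?thesis by simp
  qed
  have "(\<lambda>n. prob ?E + (\<Sum>v\<in>V. e v n)) \<longlonglongrightarrow> prob ?E + (\<Sum>v\<in>V. 0)"
    using e0 by (intro tendsto_intros) auto
  then show ?thesis using bound by (intro LIMSEQ_le_const[of _ _ ?nb]) auto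
qed

theorem proposition1p4:
  fixes d :: nat and p :: real and tb :: "frog set \<Rightarrow> frog"
  assumes "d \<ge> 2"
    and "0 \<le> p" and "p \<le> 1 / 2"
    and "tie_break tb"
    and "SFM_recurrent tb d (p_star d p)"
  shows "FM_recurrent d p"
proof (cases "p = 1 / 2")
  case True
  then show ?thesis unfolding True using FM_recurrent_half[of d] assms(1) by simp
next
  case False
  then have p: "p < 1 / 2" using assms(3) by simp
  let ?nb = "frog_space (nb_kernel d (p_star d p))" and ?M = "frog_space (FM_kernel d p)"
  interpret nb: prob_space ?nb by (rule prob_space_frog_space)
  interpret M: prob_space ?M by (rule prob_space_frog_space)
  define E where "E k = {\<omega>. \<exists>V\<in>{V. finite V}. \<exists>n. many_visitors k (\<lambda>w. set (histories V n \<omega> w))}" for k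
  define A where "A k N = {\<omega>. many_visitors k (SFM_range d \<omega> N)}" for k N
  have "AE \<omega> in ?nb. \<forall>k. \<omega> \<in> (\<Union>N. A k N)"
    using assms(5)[unfolded SFM_recurrent_def] AE_frog_path_in_tree[OF assms(1), of "p_star d p"]
  proof eventually_elim
    case (elim \<omega>)
    then have "infinite (root_visitors (\<lambda>w. \<Union>N. SFM_range d \<omega> N w))"
      by (intro SFM_infinite_root_visitors[of d \<omega> tb]) auto
    then have "\<exists>N. many_visitors k (SFM_range d \<omega> N)" for k
      using many_visitors_UN[of "SFM_range d \<omega>" k] SFM_range_incseq by metis
    then show ?case by (simp add: A_def)
  qed
  then have AE_A: "AE \<omega> in ?nb. \<omega> \<in> (\<Union>N. A k N)" for k by eventually_elim blast
  have A_meas: "A k N \<in> nb.events" for k N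
  proof -
    have fin: "finite {w. set w \<subseteq> {..<d} \<and> length w \<le> N}" by (rule finite_lists_length_le) simp
    have "SFM_range d \<omega> N
        = (\<lambda>w. unkilled_range (histories {w. set w \<subseteq> {..<d} \<and> length w \<le> N} (Suc N) \<omega> w))" for \<omega>
      by (auto simp: SFM_range_def histories_def fun_eq_iff simp del: history.simps)
    then show ?thesis
      unfolding A_def
      using measure_histories(2)[OF fin, of "\<lambda>f. many_visitors k (\<lambda>w. unkilled_range (f w))" "Suc N"]
      by simp
  qed
  have "AE \<omega> in ?M. \<omega> \<in> E k" for k
  proof -
    have inc: "incseq (A k)"
    proof (intro monoI subsetI)
      fix N M \<omega>
      assume "N \<le> M" "\<omega> \<in> A k N"
      then show "\<omega> \<in> A k M"
        using many_visitors_mono[of "SFM_range d \<omega> N" "SFM_range d \<omega> M" k]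
          incseqD[OF SFM_range_incseq[of d \<omega>]] by (auto simp: A_def)
    qed
    have "(\<lambda>N. nb.prob (A k N)) \<longlonglongrightarrow> nb.prob (\<Union>N. A k N)"
      using A_meas inc by (intro nb.finite_Lim_measure_incseq) auto
    moreover have "nb.prob (\<Union>N. A k N) = 1"
      using AE_A[of k] A_meas by (subst nb.prob_eq_1) auto
    moreover have "nb.prob (A k N) \<le> M.prob (E k)" for N
      using prob_many_visitors_dominated[OF assms(1,2) p] unfolding A_def E_def .
    ultimately have "1 \<le> M.prob (E k)"
      by (metis LIMSEQ_le_const2)
    then have "M.prob (E k) = 1" using M.prob_le_1[of "E k"] by linarith
    then show ?thesis by (simp add: M.prob_eq_1 M.AE_prob_1)
  qed
  then have "AE \<omega> in ?M. \<forall>k. \<omega> \<in> E k" by (subst AE_all_countable) blast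
  then show ?thesis
    unfolding FM_recurrent_def
  proof eventually_elim
    case (elim \<omega>)
    have "\<exists>V n. many_visitors k (\<lambda>w. if w \<in> V then set (history \<omega> w n) else {})" for k
    proof -
      obtain V n where "many_visitors k (\<lambda>w. set (histories V n \<omega> w))" using elim unfolding E_def by blast
      moreover have "(\<lambda>w. set (histories V n \<omega> w)) = (\<lambda>w. if w \<in> V then set (history \<omega> w n) else {})"
        by (simp add: histories_def fun_eq_iff)
      ultimately show ?thesis by auto
    qed
    then show ?case by (rule FM_recurrent_if_many_visitors)
  qed
qed

end
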